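(* Let $\mathcal{Y}=\{0,1\}$. For every pair of ranking functions $f_0,f_1$, let $\overline{y}^{f_i}(s)=\Pr[Y=1\mid\tilde f_i(X)=s]$, $i=0,1$. Assume $\overline{y}^{f_0}(s)$ and $\overline{y}^{f_1}(s)$ are Hölder continuous in $s$. Then, unless $\overline{y}^{f_0}(s)=\overline{y}^{f_1}(s)$ almost everywhere on $[0,1]$, $f_0$ and $f_1$ are consistently distinguishable by standard NDCG, i.e. by the ranking measure $\mathrm{NDCG}_D$ with discount $D(r)=\frac{1}{\log(1+r)}$.
   Context: $P_{XY}$ is a probability distribution on $\mathcal{X}\times\mathcal{Y}$ and $(X,Y)\sim P_{XY}$; $(x_1,y_1),(x_2,y_2),\ldots$ are i.i.d. from $P_{XY}$ and $S_n=\{(x_1,y_1),\ldots,(x_n,y_n)\}$. A ranking function is a map $f:\mathcal{X}\to\mathbb{R}$. It orders $x_1,\ldots,x_n$ by score, giving $x^f_{(1)},\ldots,x^f_{(n)}$ with $f(x^f_{(1)})\ge\cdots\ge f(x^f_{(n)})$; $y^f_{(r)}$ denotes the label of $x^f_{(r)}$. For a discount function $D$, $\mathrm{DCG}_D(f,S_n)=\sum_{r=1}^n y^f_{(r)}D(r)$; $\mathrm{IDCG}_D(S_n)=\max_{f'}\sum_{r=1}^n y^{f'}_{(r)}D(r)$ is the DCG of the best ranking of $S_n$; $\mathrm{NDCG}_D(f,S_n)=\mathrm{DCG}_D(f,S_n)/\mathrm{IDCG}_D(S_n)$. $\log$ is the natural logarithm. The canonical version of $f$ is $\tilde f(x)=\Pr_{X\sim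 P_X}[f(X)\le f(x)]$, where $P_X$ is the marginal of $X$. A function $\mathrm{neg}(N)$ is negligible if for every $c$, $\mathrm{neg}(N)<N^{-c}$ for all sufficiently large $N$. A pair $f_0,f_1$ is consistently distinguishable by a ranking measure $\mathcal{M}$ if there exist a negligible function $\mathrm{neg}(N)$ and $b\in\{0,1\}$ such that for every sufficiently large $N$, with probability $1-\mathrm{neg}(N)$, $\mathcal{M}(f_b,S_n)>\mathcal{M}(f_{1-b},S_n)$ holds for all $n\ge N$ simultaneously.
   Formalization: The scores f_0(X) and f_1(X) are assumed to have no atoms, so that the canonical scores are uniform on [0,1]; otherwise Pr[Y=1 | canonical score = s] is undefined on an interval of s and the claim fails, e.g. for two constant ranking functions. *)

theory Defs
  imports "HOL-Probability.Probability"
begin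

text \<open>
  A sample \<open>S\<^sub>n\<close> is the list of its first \<open>n\<close> labelled points, so that repetitions are kept.
  Items with equal scores stay in sample order (\<open>sort_key\<close> is stable).
\<close>

definition ranked :: "('a \<Rightarrow> real) \<Rightarrow> ('a \<times> real) list \<Rightarrow> ('a \<times> real) list" where
  "ranked f S = sort_key (\<lambda>z. - f (fst z)) S"

text \<open>Ranks \<open>r\<close> start at 1, list positions at 0.\<close>

definition DCG :: "(nat \<Rightarrow> real) \<Rightarrow> ('a \<Rightarrow> real) \<Rightarrow> ('a \<times> real) list \<Rightarrow> real" where
  "DCG D f S = (\<Sum>r = 1..length S. snd (ranked f S ! (r - 1)) * D r)"

definition IDCG :: "(nat \<Rightarrow> real) \<Rightarrow> ('a \<times> real) list \<Rightarrow> real" where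
  "IDCG D S = Max (range (\<lambda>f'. DCG D f' S))"

text \<open>The maximum above is over a finite set, hence attained.\<close>

lemma finite_range_DCG: "finite (range (\<lambda>f'. DCG D f' S))"
proof -
  let ?dcg = "\<lambda>xs. \<Sum>r = 1..length S. snd (xs ! (r - 1)) * D r"
  have "range (\<lambda>f'. DCG D f' S) \<subseteq> ?dcg ` {xs. mset xs = mset S}"
    by (auto simp: DCG_def ranked_def)
  moreover have "finite {xs. mset xs = mset S}"
    by (rule finite_subset[OF _ finite_lists_length_eq[of "set S" "length S"]])
      (auto dest: mset_eq_setD mset_eq_length)
  ultimately show ?thesis
    by (blast intro: finite_subset)
qed

text \<open>If all labels are 0, then \<open>IDCG\<close> is 0 and the quotient is 0 by convention.\<close>

definition NDCG :: "(nat \<Rightarrow> real) \<Rightarrow> ('a \<Rightarrow> real) \<Rightarrow> ('a \<times> real) list \<Rightarrow> real" where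
  "NDCG D f S = DCG D f S / IDCG D S"

definition log_discount :: "nat \<Rightarrow> real" where
  "log_discount r = 1 / ln (1 + real r)"

text \<open>\<open>Q\<close> is the marginal distribution of the instance \<open>X\<close>.\<close>

definition canonical_version :: "'a measure \<Rightarrow> ('a \<Rightarrow> real) \<Rightarrow> 'a \<Rightarrow> real" where
  "canonical_version Q f x = measure Q {x' \<in> space Q. f x' \<le> f x}"

text \<open>
  The function \<open>g\<close> is a version of \<open>s \<mapsto> Pr[Y = 1 | F(X) = s]\<close>, where \<open>F\<close> is the canonical
  version of \<open>f\<close>: composed with \<open>F(X)\<close>, it is almost surely the conditional expectation of the
  indicator of \<open>Y = 1\<close> given the sigma-algebra generated by \<open>F(X)\<close>.
\<close>

definition cond_label_prob ::
    "'a measure \<Rightarrow> ('a \<times> real) measure \<Rightarrow> ('a \<Rightarrow> real) \<Rightarrow> (real \<Rightarrow> real) \<Rightarrow> bool" where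
  "cond_label_prob MX P f g \<longleftrightarrow>
     (let F = (\<lambda>z. canonical_version (distr P MX fst) f (fst z)) in
       AE z in P. real_cond_exp P (vimage_algebra (space P) F borel)
         (indicator {z \<in> space P. snd z = 1}) z = g (F z))"

definition holder_continuous_on :: "real set \<Rightarrow> (real \<Rightarrow> real) \<Rightarrow> bool" where
  "holder_continuous_on A g \<longleftrightarrow>
     (\<exists>C \<alpha>. 0 < \<alpha> \<and> \<alpha> \<le> 1 \<and> (\<forall>s\<in>A. \<forall>t\<in>A. \<bar>g s - g t\<bar> \<le> C * \<bar>s - t\<bar> powr \<alpha>))"

definition negligible_fun :: "(nat \<Rightarrow> real) \<Rightarrow> bool" where
  "negligible_fun \<nu> \<longleftrightarrow> (\<forall>c::real. \<forall>\<^sub>F N in sequentially. \<nu> N < real N powr (- c))"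

text \<open>
  A point \<open>\<omega>\<close> of the infinite product space is the whole i.i.d. sequence of labelled points, and
  \<open>map \<omega> [0..<n]\<close> is the sample \<open>S\<^sub>n\<close>.
\<close>

definition consistently_distinguishable ::
    "('a \<times> real) measure \<Rightarrow> (('a \<Rightarrow> real) \<Rightarrow> ('a \<times> real) list \<Rightarrow> real) \<Rightarrow>
     ('a \<Rightarrow> real) \<Rightarrow> ('a \<Rightarrow> real) \<Rightarrow> bool" where
  "consistently_distinguishable P \<M> f\<^sub>0 f\<^sub>1 \<longleftrightarrow>
     (\<exists>\<nu>. negligible_fun \<nu> \<and>
       (\<exists>(f, f') \<in> {(f\<^sub>0, f\<^sub>1), (f\<^sub>1, f\<^sub>0)}. \<forall>\<^sub>F N in sequentially.
         \<P>(\<omega> in (\<Pi>\<^sub>M i\<in>(UNIV :: nat set). P).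
            \<forall>n\<ge>N. \<M> f (map \<omega> [0..<n]) > \<M> f' (map \<omega> [0..<n])) \<ge> 1 - \<nu> N))"

end

theory Submission
  imports Defs "HOL-Real_Asymp.Real_Asymp"
begin

text \<open>
  Let \<open>A\<^sub>i x = Pr[Y = 1, F\<^sub>i(X) > 1 - x]\<close>, where \<open>F\<^sub>i\<close> is the canonical version of \<open>f\<^sub>i\<close>, and \<open>\<Phi> = A\<^sub>0 - A\<^sub>1\<close>.
  Summation by parts writes DCG in terms of the numbers of positive labels among the top \<open>r\<close> items.
  Since \<open>F\<^sub>i(X)\<close> is uniform, Hoeffding's inequality at the thresholds \<open>1 - r/n\<close> shows that these numbers
  are \<open>n A\<^sub>i (r/n) + O(n powr (3/4))\<close> for all \<open>r \<le> n\<close>, except on an event whose probabilities have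
  negligible tail sums. So the difference of the two DCGs is, up to \<open>O(n powr (3/4))\<close>,
  \<open>n \<Sum>\<^sub>r (D r - D (r + 1)) \<Phi> (r/n)\<close>, and up to \<open>O(1)\<close> this is \<open>n\<close> times the integral of
  \<open>\<theta> x / (ln n + ln x)\<^sup>2\<close> over \<open>2/n \<le> x < 1\<close>, where \<open>\<theta> x = \<Phi> x / x\<close> is bounded.

  Expanding the kernel in powers of \<open>1 / ln n\<close>, the integral is asymptotically a nonzero constant times
  \<open>1 / (ln n)\<close> to the power \<open>K + 2\<close>, where \<open>K\<close> is the least order for which \<open>\<theta>\<close> has a nonzero logarithmic
  moment \<open>\<integral> \<theta> x (ln x)^K dx\<close>. If there were no such \<open>K\<close>, then all power moments of \<open>\<theta>\<close> would vanish
  too, hence \<open>\<Phi> = 0\<close> by Weierstrass approximation, hence \<open>y\<^sub>0 = y\<^sub>1\<close> by continuity. Hence the difference has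
  a definite sign for large \<open>n\<close>. Both NDCGs have the same denominator.
\<close>

subsection \<open>Logarithmic moments on the unit interval\<close>

lemma pow_le_exp:
  fixes y :: real
  assumes "0 \<le> y"
  shows "y ^ k \<le> fact k * exp y"
proof -
  have "y ^ k /\<^sub>R fact k \<le> (\<Sum>n. y ^ n /\<^sub>R fact n)"
    using sum_le_suminf[OF summable_exp_generic[of y], of "{k}"] assms by simp
  then show ?thesis
    by (simp add: exp_def field_simps)
qed

lemma set_integrable_powr_unit_interval:
  fixes a :: real
  assumes "- 1 < a"
  shows "set_integrable lborel {0<..<1} (\<lambda>x. x powr a)"
proof -
  have "(\<lambda>x. x powr a) absolutely_integrable_on {0..1}"
    by (intro nonnegative_absolutely_integrable_1 integrable_on_powr_from_0 assms) auto
  then have "set_integrable lborel {0..1} (\<lambda>x. x powr a)"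
    by (simp add: set_integrable_def integrable_completion)
  then show ?thesis
    by (rule set_integrable_subset) auto
qed

text \<open>A quarter of an exponent absorbs any power of the logarithm (apply
  \<open>pow_le_exp\<close> to \<open>- ln x / 4\<close>), and the exponent -3/4 that remains is
  still integrable at 0.\<close>

lemma set_integrable_ln_power:
  "set_integrable lborel {0<..<1::real} (\<lambda>x. \<bar>ln x\<bar> ^ k * x powr (-1/2))"
proof (rule set_integrable_bound)
  show "set_integrable lborel {0<..<1} (\<lambda>x::real. 4 ^ k * fact k * x powr (-3/4))"
    by (intro set_integrable_mult_right set_integrable_powr_unit_interval) auto
  show "set_borel_measurable lborel {0<..<1} (\<lambda>x::real. \<bar>ln x\<bar> ^ k * x powr (-1/2))"
    unfolding set_borel_measurable_def by measurable
  show "AE x::real in lborel. x \<in> {0<..<1} \<longrightarrow>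
     norm (\<bar>ln x\<bar> ^ k * x powr (-1/2)) \<le> norm (4 ^ k * fact k * x powr (-3/4))"
  proof (intro AE_I2 impI)
    fix x :: real assume x: "x \<in> {0<..<1}"
    have "(- ln x / 4) ^ k \<le> fact k * exp (- ln x / 4)"
      by (rule pow_le_exp) (use x in auto)
    also have "exp (- ln x / 4) = x powr (-1/4)"
      using x by (simp add: powr_def)
    finally have "(- ln x) ^ k \<le> 4 ^ k * fact k * x powr (-1/4)"
      using power_mult_distrib[of 4 "- ln x / 4" k]
      by (simp add: mult.assoc mult.left_commute)
    then have "\<bar>ln x\<bar> ^ k \<le> 4 ^ k * fact k * x powr (-1/4)"
      using x by simp
    then have "\<bar>ln x\<bar> ^ k * x powr (-1/2) \<le> 4 ^ k * fact k * x powr (-1/4) * x powr (-1/2)"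
      by (rule mult_right_mono) simp
    also have "\<dots> = 4 ^ k * fact k * x powr (-3/4)"
      using x by (simp add: powr_add[symmetric])
    finally show "norm (\<bar>ln x\<bar> ^ k * x powr (-1/2)) \<le> norm (4 ^ k * fact k * x powr (-3/4))"
      by (simp add: abs_mult)
  qed
qed

text \<open>On the unit interval \<open>x powr (-1/2)\<close> dominates \<open>x powr s\<close> for
  every nonnegative \<open>s\<close>, so one majorant serves all exponents.\<close>

lemma set_integrable_bounded_ln_power:
  fixes \<theta> :: "real \<Rightarrow> real"
  assumes [measurable]: "\<theta> \<in> borel_measurable borel"
    and C: "\<And>x. x \<in> {0<..<1} \<Longrightarrow> \<bar>\<theta> x\<bar> \<le> C" and "0 \<le> s"
  shows "set_integrable lborel {0<..<1} (\<lambda>x. \<theta> x * ln x ^ k * x powr s)"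
proof (rule set_integrable_bound)
  show "set_integrable lborel {0<..<1} (\<lambda>x. C * (\<bar>ln x\<bar> ^ k * x powr (-1/2)))"
    by (intro set_integrable_mult_right set_integrable_ln_power)
  show "set_borel_measurable lborel {0<..<1} (\<lambda>x. \<theta> x * ln x ^ k * x powr s)"
    unfolding set_borel_measurable_def by measurable
  show "AE x in lborel. x \<in> {0<..<1} \<longrightarrow>
     norm (\<theta> x * ln x ^ k * x powr s) \<le> norm (C * (\<bar>ln x\<bar> ^ k * x powr (-1/2)))"
  proof (intro AE_I2 impI)
    fix x :: real assume x: "x \<in> {0<..<1}"
    have "0 \<le> C" using C[OF x] by simp
    have "\<bar>\<theta> x\<bar> * (\<bar>ln x\<bar> ^ k * x powr s) \<le> C * (\<bar>ln x\<bar> ^ k * x powr (-1/2))"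
      using x C[OF x] \<open>0 \<le> s\<close>
      by (intro mult_mono powr_mono') auto
    then show "norm (\<theta> x * ln x ^ k * x powr s) \<le> norm (C * (\<bar>ln x\<bar> ^ k * x powr (-1/2)))"
      using \<open>0 \<le> C\<close> by (simp add: abs_mult power_abs mult.assoc)
  qed
qed

text \<open>
  Expand \<open>x powr (1/2) = exp (ln x / 2)\<close> into its power series. The step in the exponent has to be
  less than 1: the partial sums are dominated only by \<open>x powr (-1/2)\<close>, which must be integrable.
\<close>

lemma ln_moments_shift:
  fixes \<theta> :: "real \<Rightarrow> real"
  assumes [measurable]: "\<theta> \<in> borel_measurable borel"
    and C: "\<And>x. x \<in> {0<..<1} \<Longrightarrow> \<bar>\<theta> x\<bar> \<le> C" and "0 \<le> s"
    and zero: "\<And>k. (LINT x:{0<..<1}|lborel. \<theta> x * ln x ^ k * x powr s) = 0"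
  shows "(LINT x:{0<..<1}|lborel. \<theta> x * ln x ^ k * x powr (s + 1/2)) = 0"
proof -
  let ?I = "indicator {0<..<1::real} :: real \<Rightarrow> real"
  let ?h = "\<lambda>x. \<theta> x * ln x ^ k * x powr s"
  let ?S = "\<lambda>N x. \<Sum>j<N. (ln x / 2) ^ j /\<^sub>R fact j"
  have "(\<lambda>N. LINT x|lborel. ?I x * (?h x * ?S N x)) \<longlonglongrightarrow>
     (LINT x|lborel. ?I x * (?h x * x powr (1/2)))"
  proof (rule integral_dominated_convergence)
    show "(\<lambda>x. ?I x * (?h x * x powr (1/2))) \<in> borel_measurable lborel" by measurable
    show "\<And>N. (\<lambda>x. ?I x * (?h x * ?S N x)) \<in> borel_measurable lborel" by measurable
    show "integrable lborel (\<lambda>x. ?I x * (C * (\<bar>ln x\<bar> ^ k * x powr (-1/2))))"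
      using set_integrable_mult_right[OF set_integrable_ln_power, of C k]
      by (simp add: set_integrable_def)
    show "AE x in lborel. (\<lambda>N. ?I x * (?h x * ?S N x)) \<longlonglongrightarrow> ?I x * (?h x * x powr (1/2))"
    proof (rule AE_I2)
      fix x :: real
      show "(\<lambda>N. ?I x * (?h x * ?S N x)) \<longlonglongrightarrow> ?I x * (?h x * x powr (1/2))"
      proof (cases "x \<in> {0<..<1}")
        case True
        have "(\<lambda>N. ?S N x) \<longlonglongrightarrow> exp (ln x / 2)"
          using exp_converges[of "ln x / 2"] unfolding sums_def by blast
        moreover have "exp (ln x / 2) = x powr (1/2)"
          using True by (simp add: powr_def)
        ultimately show ?thesis by (auto intro!: tendsto_intros)
      qed auto
    qed
    fix N
    show "AE x in lborel. norm (?I x * (?h x * ?S N x)) \<le> ?I x * (C * (\<bar>ln x\<bar> ^ k * x powr (-1/2)))"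
    proof (rule AE_I2)
      fix x :: real
      show "norm (?I x * (?h x * ?S N x)) \<le> ?I x * (C * (\<bar>ln x\<bar> ^ k * x powr (-1/2)))"
      proof (cases "x \<in> {0<..<1}")
        case True
        have "\<bar>?S N x\<bar> \<le> (\<Sum>j<N. \<bar>ln x / 2\<bar> ^ j /\<^sub>R fact j)"
          by (rule order_trans[OF sum_abs]) (simp add: abs_mult power_abs abs_inverse)
        also have "\<dots> \<le> exp \<bar>ln x / 2\<bar>"
          unfolding exp_def by (intro sum_le_suminf summable_exp_generic) auto
        also have "\<dots> = x powr (-1/2)"
          using True by (simp add: powr_def)
        finally have S: "\<bar>?S N x\<bar> \<le> x powr (-1/2)" .
        have "\<bar>\<theta> x\<bar> * \<bar>ln x\<bar> ^ k * x powr s \<le> C * \<bar>ln x\<bar> ^ k * 1"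
          using True C[OF True] \<open>0 \<le> s\<close>
          by (intro mult_mono powr_le1) auto
        then have "\<bar>?h x\<bar> \<le> C * \<bar>ln x\<bar> ^ k"
          by (simp add: abs_mult power_abs)
        with S have "\<bar>?h x\<bar> * \<bar>?S N x\<bar> \<le> (C * \<bar>ln x\<bar> ^ k) * x powr (-1/2)"
          by (intro mult_mono) auto
        then show ?thesis using True by (simp add: abs_mult mult.assoc)
      qed auto
    qed
  qed
  \<comment> \<open>A partial sum only raises the power of the logarithm, so this integral is a
    finite combination of the moments of order \<open>k + j\<close>, all of which vanish.\<close>
  moreover have "(LINT x|lborel. ?I x * (?h x * ?S N x)) = 0" for N
  proof -
    have int: "integrable lborel (\<lambda>x. ?I x * (\<theta> x * ln x ^ (k + j) * x powr s))" for j
      using set_integrable_bounded_ln_power[OF assms(1) C \<open>0 \<le> s\<close>, of "k + j"]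
      by (simp add: set_integrable_def)
    have "(LINT x|lborel. ?I x * (?h x * ?S N x)) =
      (LINT x|lborel. (\<Sum>j<N. (1 / (2 ^ j * fact j)) * (?I x * (\<theta> x * ln x ^ (k + j) * x powr s))))"
      by (intro Bochner_Integration.integral_cong)
        (auto simp: sum_distrib_left power_divide power_add field_simps intro!: sum.cong)
    also have "\<dots> = (\<Sum>j<N. (1 / (2 ^ j * fact j)) * (LINT x|lborel. ?I x * (\<theta> x * ln x ^ (k + j) * x powr s)))"
      using int by (subst Bochner_Integration.integral_sum) auto
    also have "\<dots> = 0"
      using zero by (simp add: set_lebesgue_integral_def)
    finally show ?thesis .
  qed
  ultimately have "(LINT x|lborel. ?I x * (?h x * x powr (1/2))) = 0"
    by (simp add: LIMSEQ_const_iff)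
  then show ?thesis
    by (simp add: set_lebesgue_integral_def powr_add mult.assoc)
qed

text \<open>Shift the exponent \<open>2 * m\<close> times by one half. The induction carries all
  orders \<open>k\<close> along, since one shift consumes every logarithmic moment at the previous
  exponent.\<close>

lemma ln_moments_vanish_imp_power_moments_vanish:
  fixes \<theta> :: "real \<Rightarrow> real"
  assumes [measurable]: "\<theta> \<in> borel_measurable borel"
    and C: "\<And>x. x \<in> {0<..<1} \<Longrightarrow> \<bar>\<theta> x\<bar> \<le> C"
    and zero: "\<And>k. (LINT x:{0<..<1}|lborel. \<theta> x * ln x ^ k) = 0"
  shows "(LINT x:{0<..<1}|lborel. \<theta> x * x ^ m) = 0"
proof -
  have "\<forall>k. (LINT x:{0<..<1}|lborel. \<theta> x * ln x ^ k * x powr (real j / 2)) = 0" for j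
  proof (induction j)
    case 0
    have "(LINT x:{0<..<1}|lborel. \<theta> x * ln x ^ k * x powr (real 0 / 2)) =
        (LINT x:{0<..<1}|lborel. \<theta> x * ln x ^ k)" for k
      by (intro set_lebesgue_integral_cong) auto
    then show ?case using zero by simp
  next
    case (Suc j)
    then show ?case
      using ln_moments_shift[OF assms(1) C, of "real j / 2"]
      by (simp add: add_divide_distrib add.commute)
  qed
  then have "(LINT x:{0<..<1}|lborel. \<theta> x * ln x ^ 0 * x powr (real (2 * m) / 2)) = 0"
    by blast
  moreover have "(LINT x:{0<..<1}|lborel. \<theta> x * ln x ^ 0 * x powr (real (2 * m) / 2)) =
     (LINT x:{0<..<1}|lborel. \<theta> x * x ^ m)"
    by (intro set_lebesgue_integral_cong) (auto simp: powr_realpow)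
  ultimately show ?thesis by simp
qed

text \<open>Otherwise \<theta> = \<Phi> x / x is orthogonal to all polynomials. The test function to
  approximate is \<Phi>, which is continuous up to 0, whereas \<theta> need not extend continuously.
  Orthogonality of \<theta> to \<Phi> makes the integral of (\<Phi> x)^2 / x vanish.\<close>

lemma exists_nonzero_ln_moment:
  fixes \<Phi> :: "real \<Rightarrow> real"
  assumes cont: "continuous_on UNIV \<Phi>"
    and C: "\<And>x. x \<in> {0<..<1} \<Longrightarrow> \<bar>\<Phi> x\<bar> \<le> C * x"
    and x0: "x0 \<in> {0<..<1}" "\<Phi> x0 \<noteq> 0"
  shows "\<exists>k. (LINT x:{0<..<1}|lborel. \<Phi> x / x * ln x ^ k) \<noteq> 0"
proof (rule ccontr)
  assume "\<not> ?thesis"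
  then have zero: "(LINT x:{0<..<1}|lborel. \<Phi> x / x * ln x ^ k) = 0" for k by blast
  let ?\<theta> = "\<lambda>x. \<Phi> x / x" and ?I = "{0<..<1::real}"
  have [measurable]: "\<Phi> \<in> borel_measurable borel"
    by (rule borel_measurable_continuous_onI[OF cont])
  have \<theta>: "\<bar>?\<theta> x\<bar> \<le> C" if "x \<in> ?I" for x
    using C[OF that] that by (simp add: abs_mult field_simps)
  have "C \<ge> 0" using \<theta>[OF x0(1)] by linarith
  have pow: "(LINT x:?I|lborel. ?\<theta> x * x ^ m) = 0" for m
    by (rule ln_moments_vanish_imp_power_moments_vanish[OF _ \<theta> zero]) auto
  have bint: "set_integrable lborel ?I (\<lambda>x. ?\<theta> x * g x)"
    if g: "continuous_on UNIV g" for g :: "real \<Rightarrow> real"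
  proof -
    have [measurable]: "g \<in> borel_measurable borel"
      by (rule borel_measurable_continuous_onI[OF g])
    have "compact (g ` {0..1})"
      by (rule compact_continuous_image[OF continuous_on_subset[OF g]]) auto
    then obtain B where B: "\<And>x. x \<in> {0..1} \<Longrightarrow> \<bar>g x\<bar> \<le> B"
      by (metis bounded_iff compact_imp_bounded imageI real_norm_def)
    have i1: "set_integrable lborel ?I (\<lambda>x. C * B)"
      by (simp add: set_integrable_def)
    show ?thesis
    proof (rule set_integrable_bound[OF i1])
      show "set_borel_measurable lborel ?I (\<lambda>x. ?\<theta> x * g x)"
        unfolding set_borel_measurable_def by measurable
      have "\<bar>?\<theta> x\<bar> * \<bar>g x\<bar> \<le> C * B" if "x \<in> ?I" for x
        using \<theta>[OF that] B[of x] that \<open>C \<ge> 0\<close> by (intro mult_mono) auto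
      moreover have "C * B \<le> \<bar>C * B\<bar>" by simp
      ultimately show "AE x in lborel. x \<in> ?I \<longrightarrow> norm (?\<theta> x * g x) \<le> norm (C * B)"
        unfolding real_norm_def abs_mult
        by (metis (mono_tags, lifting) AE_I2 abs_mult order_trans)
    qed
  qed
  have poly: "(LINT x:?I|lborel. ?\<theta> x * p x) = 0" if "real_polynomial_function p" for p
  proof -
    obtain a n where p: "p = (\<lambda>x. \<Sum>i\<le>n. a i * x ^ i)"
      using real_polynomial_function_imp_sum[OF \<open>real_polynomial_function p\<close>] by blast
    have "(LINT x:?I|lborel. ?\<theta> x * p x) = (LINT x:?I|lborel. \<Sum>i\<le>n. a i * (?\<theta> x * x ^ i))"
      by (intro set_lebesgue_integral_cong)
        (auto simp: p sum_distrib_left sum_divide_distrib mult_ac intro!: sum.cong)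
    also have "\<dots> = (\<Sum>i\<le>n. LINT x:?I|lborel. a i * (?\<theta> x * x ^ i))"
    proof -
      have "set_integrable lborel ?I (\<lambda>x. a i * (?\<theta> x * x ^ i))" for i
        by (intro set_integrable_mult_right bint continuous_intros)
      then show ?thesis
        unfolding set_lebesgue_integral_def scaleR_sum_right set_integrable_def
        by (rule Bochner_Integration.integral_sum)
    qed
    also have "\<dots> = 0"
      by (simp only: set_integral_mult_right pow mult_zero_right sum.neutral_const)
    finally show ?thesis .
  qed
  have small: "\<bar>LINT x:?I|lborel. ?\<theta> x * \<Phi> x\<bar> \<le> C * e" if "e > 0" for e
  proof -
    obtain p where p: "real_polynomial_function p" "\<And>x. x \<in> {0..1} \<Longrightarrow> \<bar>\<Phi> x - p x\<bar> < e"
      using Stone_Weierstrass_real_polynomial_function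
        [OF compact_Icc continuous_on_subset[OF cont] \<open>e > 0\<close>, of 0 1] by auto
    have cp: "continuous_on UNIV p"
      using p(1) by (simp add: continuous_on_polymonial_function real_polynomial_function_eq)
    have cd: "continuous_on UNIV (\<lambda>x. \<Phi> x - p x)"
      by (intro continuous_intros cont cp)
    have "(LINT x:?I|lborel. ?\<theta> x * \<Phi> x) = (LINT x:?I|lborel. ?\<theta> x * \<Phi> x) - (LINT x:?I|lborel. ?\<theta> x * p x)"
      using poly[OF p(1)] by simp
    also have "\<dots> = (LINT x:?I|lborel. ?\<theta> x * \<Phi> x - ?\<theta> x * p x)"
      by (rule set_integral_diff(2)[symmetric]) (intro bint cont cp)+
    also have "\<dots> = (LINT x:?I|lborel. ?\<theta> x * (\<Phi> x - p x))"
      by (simp add: right_diff_distrib)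
    finally have "\<bar>LINT x:?I|lborel. ?\<theta> x * \<Phi> x\<bar> = \<bar>LINT x:?I|lborel. ?\<theta> x * (\<Phi> x - p x)\<bar>" by simp
    also have "\<dots> \<le> (LINT x:?I|lborel. \<bar>?\<theta> x * (\<Phi> x - p x)\<bar>)"
      using set_integral_norm_bound[OF bint[OF cd]] by simp
    also have "\<dots> \<le> (LINT x:?I|lborel. C * e)"
    proof (rule set_integral_mono)
      show "set_integrable lborel ?I (\<lambda>x. \<bar>?\<theta> x * (\<Phi> x - p x)\<bar>)"
        by (rule set_integrable_abs[OF bint[OF cd]])
      show "set_integrable lborel ?I (\<lambda>x. C * e)" by (simp add: set_integrable_def)
      fix x :: real assume x: "x \<in> ?I"
      then show "\<bar>?\<theta> x * (\<Phi> x - p x)\<bar> \<le> C * e"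
        unfolding abs_mult using \<theta>[OF x] p(2)[of x] \<open>C \<ge> 0\<close> by (intro mult_mono) auto
    qed
    also have "\<dots> = C * e"
      by (simp add: set_lebesgue_integral_def)
    finally show ?thesis .
  qed
  have "(LINT x:?I|lborel. ?\<theta> x * \<Phi> x) = 0"
  proof (rule ccontr)
    assume n: "\<not> ?thesis"
    let ?v = "\<bar>LINT x:?I|lborel. ?\<theta> x * \<Phi> x\<bar>"
    \<comment> \<open>With this \<open>e\<close> the bound \<open>C * e\<close> is less than half of
      \<open>?v\<close>; the summand 1 keeps the denominator positive when
      \<open>C = 0\<close>.\<close>
    have "?v \<le> C * (?v / (2 * (C + 1)))"
      using n \<open>C \<ge> 0\<close> by (intro small) auto
    also have "\<dots> = ?v * (C / (2 * (C + 1)))" by simp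
    also have "\<dots> < ?v * 1"
      using n \<open>C \<ge> 0\<close> by (intro mult_strict_left_mono) auto
    finally show False by simp
  qed
  \<comment> \<open>The integrand is (\<Phi> x)^2 / x, hence nonnegative. The set where \<Phi> does
    not vanish is then open and null, so empty, although it contains \<open>x0\<close>.\<close>
  then have "AE x in lborel. indicator ?I x *\<^sub>R (?\<theta> x * \<Phi> x) = 0"
    unfolding set_lebesgue_integral_def
    by (subst (asm) integral_nonneg_eq_0_iff_AE)
      (use bint[OF cont] in \<open>auto simp: set_integrable_def split: split_indicator\<close>)
  then have "AE x in lborel. \<not> (x \<in> ?I \<and> \<Phi> x \<noteq> 0)"
    by eventually_elim (auto split: split_indicator_asm)
  moreover have op: "open {x. x \<in> ?I \<and> \<Phi> x \<noteq> 0}"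
    by (intro open_Collect_conj open_Collect_neq continuous_intros cont)
      (auto simp: greaterThanLessThan_def greaterThan_def lessThan_def intro!: open_Collect_conj open_Collect_less continuous_intros)
  ultimately have "{x. x \<in> ?I \<and> \<Phi> x \<noteq> 0} \<in> null_sets lborel"
    by (subst AE_iff_null_sets) (simp_all add: borel_open)
  then have "negligible {x. x \<in> ?I \<and> \<Phi> x \<noteq> 0}"
    using negligible_iff_null_sets null_sets_completionI by blast
  with op x0 show False
    using open_not_negligible by blast
qed

subsection \<open>Asymptotics of discounted sums\<close>

text \<open>The exact remainder of the series of 1 / (1 - \<tau>/L)^2, whose terms are (k + 1)
  (\<tau>/L)^k, after \<open>K\<close> terms and multiplied by \<open>L ^ K\<close>. Clearing the
  denominator first turns the claim into a polynomial identity, provable by induction on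
  \<open>K\<close>.\<close>

lemma inverse_square_expansion:
  fixes L \<tau> :: real
  assumes "\<tau> \<noteq> L"
  shows "L ^ (K + 2) / (L - \<tau>)\<^sup>2 - (\<Sum>k<K. real (k + 1) * \<tau> ^ k * L ^ (K - k)) =
    \<tau> ^ K * (real (K + 1) * L\<^sup>2 - real K * \<tau> * L) / (L - \<tau>)\<^sup>2"
proof -
  let ?S = "\<lambda>K. \<Sum>k<K. real (k + 1) * \<tau> ^ k * L ^ (K - k)"
  have "(L - \<tau>)\<^sup>2 * ?S K = L ^ (K + 2) - real (K + 1) * \<tau> ^ K * L\<^sup>2 + real K * \<tau> ^ (K + 1) * L"
  proof (induction K)
    case (Suc K)
    have "?S (Suc K) = L * ?S K + real (K + 1) * \<tau> ^ K * L"
      by (simp add: sum_distrib_left Suc_diff_le mult_ac)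
    then have "(L - \<tau>)\<^sup>2 * ?S (Suc K) = L * ((L - \<tau>)\<^sup>2 * ?S K) + (L - \<tau>)\<^sup>2 * (real (K + 1) * \<tau> ^ K * L)"
      by (simp add: algebra_simps)
    also have "\<dots> = L ^ (Suc K + 2) - real (Suc K + 1) * \<tau> ^ Suc K * L\<^sup>2 + real (Suc K) * \<tau> ^ (Suc K + 1) * L"
      unfolding Suc.IH by (simp add: algebra_simps power2_eq_square)
    finally show ?case .
  qed (simp add: power2_eq_square)
  moreover have "(L - \<tau>)\<^sup>2 \<noteq> 0" using assms by simp
  ultimately show ?thesis
    by (simp add: field_simps del: power_eq_0_iff)
qed

text \<open>
  With \<open>L = ln n\<close> and \<open>\<tau> = - ln x\<close>, the kernel is \<open>1 / (ln (n x))\<^sup>2 = 1 / (L - \<tau>)\<^sup>2\<close>. The first summand below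
  is the bound for \<open>\<tau> \<le> L / 2\<close>, the second one for \<open>L / 2 < \<tau> \<le> L - ln 2\<close>, where \<open>L \<le> 2 \<tau>\<close>, and
  the third one for \<open>\<tau> > L - ln 2\<close>, where only the subtracted polynomial is left.
\<close>

definition kernel_dominator :: "nat \<Rightarrow> real \<Rightarrow> real" where
  "kernel_dominator K \<tau> = 4 * real (K + 1) * \<tau> ^ K + 4 * real (K + 1) / (ln 2)\<^sup>2 * \<tau> ^ (K + 2) +
     (\<Sum>k<K. real (k + 1) * 2 ^ K) * \<tau> ^ K"

lemma kernel_le_dominator:
  fixes L \<tau> :: real
  assumes "0 \<le> \<tau>" "\<tau> \<le> L - ln 2"
  shows "\<bar>L ^ (K + 2) / (L - \<tau>)\<^sup>2 - (\<Sum>k<K. real (k + 1) * \<tau> ^ k * L ^ (K - k))\<bar> \<le> kernel_dominator K \<tau>"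
proof -
  have ln2: "0 < ln (2::real)" by simp
  have L: "\<tau> < L" "0 < L" "ln 2 \<le> L - \<tau>" using assms ln2 by linarith+
  \<comment> \<open>Because 0 \<le> \<tau> < L, the factor in the numerator of the exact remainder
    lies between 0 and its first term. This leaves only L / (L - \<tau>) to be estimated.\<close>
  have up: "real (K + 1) * L\<^sup>2 - real K * \<tau> * L \<le> real (K + 1) * L\<^sup>2"
    using L assms by simp
  have "real K * \<tau> * L \<le> real (K + 1) * L * L"
    using L assms by (intro mult_mono) auto
  then have lo: "0 \<le> real (K + 1) * L\<^sup>2 - real K * \<tau> * L"
    by (simp add: power2_eq_square algebra_simps)
  have A: "\<bar>\<tau> ^ K * (real (K + 1) * L\<^sup>2 - real K * \<tau> * L) / (L - \<tau>)\<^sup>2\<bar> \<le>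
      \<tau> ^ K * (real (K + 1) * L\<^sup>2) / (L - \<tau>)\<^sup>2"
    using divide_right_mono[OF mult_left_mono[OF up, of "\<tau> ^ K"], of "(L - \<tau>)\<^sup>2"] lo assms
    by (simp add: abs_mult)
  also have "\<dots> = \<tau> ^ K * real (K + 1) * (L / (L - \<tau>))\<^sup>2"
    by (simp add: power_divide)
  also have "\<dots> \<le> \<tau> ^ K * real (K + 1) * (4 + 4 / (ln 2)\<^sup>2 * \<tau>\<^sup>2)"
  proof (intro mult_left_mono)
    show "(L / (L - \<tau>))\<^sup>2 \<le> 4 + 4 / (ln 2)\<^sup>2 * \<tau>\<^sup>2"
    proof (cases "\<tau> \<le> L / 2")
      case True
      then have "L / (L - \<tau>) \<le> 2" using L by (simp add: field_simps)
      then have "(L / (L - \<tau>))\<^sup>2 \<le> 2\<^sup>2"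
        using L by (intro power_mono) auto
      then show ?thesis by (simp add: add_increasing2)
    next
      case False
      have "L / (L - \<tau>) \<le> (2 * \<tau>) / ln 2"
        using False L assms by (intro frac_le) auto
      then have "(L / (L - \<tau>))\<^sup>2 \<le> ((2 * \<tau>) / ln 2)\<^sup>2"
        using L by (intro power_mono) auto
      then show ?thesis by (simp add: power_divide power_mult_distrib)
    qed
  qed (use assms in auto)
  also have "\<dots> \<le> kernel_dominator K \<tau>"
    using assms by (simp add: kernel_dominator_def algebra_simps power2_eq_square sum_nonneg)
  finally show ?thesis
    using inverse_square_expansion[of \<tau> L K] L by simp
qed

lemma kernel_tail_le_dominator:
  fixes L \<tau> :: real
  assumes "2 * ln 2 \<le> L" "L - ln 2 < \<tau>"
  shows "\<bar>\<Sum>k<K. real (k + 1) * \<tau> ^ k * L ^ (K - k)\<bar> \<le> kernel_dominator K \<tau>"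
proof -
  have ln2: "0 < ln (2::real)" by simp
  \<comment> \<open>The lower bound on \<open>L\<close> gives \<open>L - ln 2 \<ge> L / 2\<close>,
    so \<tau> exceeds half of \<open>L\<close> and every power of \<open>L\<close> can be traded for
    one of \<tau>.\<close>
  have L: "0 < L" "L \<le> 2 * \<tau>" "0 < \<tau>" using assms ln2 by linarith+
  have "\<bar>\<Sum>k<K. real (k + 1) * \<tau> ^ k * L ^ (K - k)\<bar> = (\<Sum>k<K. real (k + 1) * \<tau> ^ k * L ^ (K - k))"
    using L by (intro abs_of_nonneg sum_nonneg) auto
  also have "\<dots> \<le> (\<Sum>k<K. real (k + 1) * 2 ^ K * \<tau> ^ K)"
  proof (rule sum_mono)
    fix k assume "k \<in> {..<K}"
    then have k: "k + (K - k) = K" by simp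
    have "L ^ (K - k) \<le> (2 * \<tau>) ^ (K - k)" using L by (intro power_mono) auto
    also have "\<dots> \<le> 2 ^ K * \<tau> ^ (K - k)"
      using L by (simp add: power_mult_distrib mult_right_mono power_increasing)
    finally have "real (k + 1) * \<tau> ^ k * L ^ (K - k) \<le> real (k + 1) * \<tau> ^ k * (2 ^ K * \<tau> ^ (K - k))"
      using L by (intro mult_left_mono) auto
    also have "\<dots> = real (k + 1) * 2 ^ K * \<tau> ^ (k + (K - k))"
      by (simp add: power_add mult_ac)
    finally show "real (k + 1) * \<tau> ^ k * L ^ (K - k) \<le> real (k + 1) * 2 ^ K * \<tau> ^ K"
      unfolding k .
  qed
  also have "\<dots> = (\<Sum>k<K. real (k + 1) * 2 ^ K) * \<tau> ^ K"
    by (simp add: sum_distrib_right)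
  also have "\<dots> \<le> kernel_dominator K \<tau>"
    using L by (simp add: kernel_dominator_def)
  finally show ?thesis .
qed

text \<open>In the exact remainder only a quotient of two quadratics in \<open>L\<close> varies; its
  limit is the quotient of the leading coefficients.\<close>

lemma kernel_tendsto:
  fixes \<tau> :: real
  shows "((\<lambda>L. L ^ (K + 2) / (L - \<tau>)\<^sup>2 - (\<Sum>k<K. real (k + 1) * \<tau> ^ k * L ^ (K - k)))
     \<longlongrightarrow> real (K + 1) * \<tau> ^ K) at_top"
proof -
  have "((\<lambda>L. (c * L\<^sup>2 - d * \<tau> * L) / (L - \<tau>)\<^sup>2) \<longlongrightarrow> c) at_top" for c d :: real
    by real_asymp
  then have "((\<lambda>L. \<tau> ^ K * ((real (K + 1) * L\<^sup>2 - real K * \<tau> * L) / (L - \<tau>)\<^sup>2))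
      \<longlongrightarrow> \<tau> ^ K * real (K + 1)) at_top"
    by (intro tendsto_intros)
  moreover have "\<forall>\<^sub>F L in at_top. \<tau> ^ K * ((real (K + 1) * L\<^sup>2 - real K * \<tau> * L) / (L - \<tau>)\<^sup>2) =
      L ^ (K + 2) / (L - \<tau>)\<^sup>2 - (\<Sum>k<K. real (k + 1) * \<tau> ^ k * L ^ (K - k))"
    using eventually_gt_at_top[of \<tau>]
    by eventually_elim (subst inverse_square_expansion, auto)
  ultimately show ?thesis
    by (simp add: mult.commute tendsto_cong)
qed

text \<open>Subtract from the rescaled kernel the first \<open>K\<close> terms of its expansion.
  They integrate to multiples of the moments of order below \<open>K\<close>, that is to 0, so the
  integral is unchanged, while the difference now converges pointwise under the integrable bound
  \<open>kernel_dominator\<close>.\<close>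

lemma tendsto_ln_power_times_kernel_integral:
  fixes \<theta> :: "real \<Rightarrow> real"
  assumes [measurable]: "\<theta> \<in> borel_measurable borel"
    and C: "\<And>x. x \<in> {0<..<1} \<Longrightarrow> \<bar>\<theta> x\<bar> \<le> C"
    and zero: "\<And>k. k < K \<Longrightarrow> (LINT x:{0<..<1}|lborel. \<theta> x * ln x ^ k) = 0"
  shows "(\<lambda>n. ln (real n) ^ (K + 2) * (LINT x:{2 / real n..<1}|lborel. \<theta> x / (ln (real n * x))\<^sup>2))
    \<longlonglongrightarrow> real (K + 1) * (LINT x:{0<..<1}|lborel. \<theta> x * (- ln x) ^ K)"
proof (rule LIMSEQ_offset[where k = 4])
  let ?I = "indicator {0<..<1::real} :: real \<Rightarrow> real"
  \<comment> \<open>The shift by 4 guarantees \<open>2 * ln 2 \<le> ?L n\<close>, as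
    \<open>kernel_tail_le_dominator\<close> requires.\<close>
  let ?L = "\<lambda>n. ln (real (n + 4))"
  let ?J = "\<lambda>n. indicator {2 / real (n + 4)..<1::real} :: real \<Rightarrow> real"
  let ?S = "\<lambda>n x. \<Sum>k<K. real (k + 1) * (- ln x) ^ k * ?L n ^ (K - k)"
  \<comment> \<open>The cutoff \<open>?J\<close> applies to the kernel only. The polynomial is
    subtracted on the whole unit interval, so that its integral involves complete moments; left of
    the cutoff it is all that remains.\<close>
  let ?R = "\<lambda>n x. ?J n x * (?L n ^ (K + 2) / (?L n - (- ln x))\<^sup>2) - ?S n x"
  have lnint: "integrable lborel (\<lambda>x. ?I x * (\<theta> x * ln x ^ k))" for k
  proof -
    have "integrable lborel (\<lambda>x. ?I x * (\<theta> x * ln x ^ k * x powr 0))"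
      using set_integrable_bounded_ln_power[OF assms(1) C order_refl, of k]
      by (simp add: set_integrable_def)
    moreover have "(\<lambda>x. ?I x * (\<theta> x * ln x ^ k * x powr 0)) = (\<lambda>x. ?I x * (\<theta> x * ln x ^ k))"
      by (auto split: split_indicator)
    ultimately show ?thesis by simp
  qed
  have domint: "integrable lborel (\<lambda>x. ?I x * (C * \<bar>ln x\<bar> ^ k))" for k
  proof -
    have "set_integrable lborel {0<..<1} (\<lambda>x. C * ln x ^ k * x powr 0)"
      by (rule set_integrable_bounded_ln_power[where C = "\<bar>C\<bar>"]) auto
    from set_integrable_abs[OF this]
    have "integrable lborel (\<lambda>x. ?I x * \<bar>C * ln x ^ k * x powr 0\<bar>)"
      by (simp add: set_integrable_def)
    \<comment> \<open>The instance of the bound at 1/2 supplies \<open>0 \<le> C\<close>.\<close>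
    moreover have "(\<lambda>x. ?I x * \<bar>C * ln x ^ k * x powr 0\<bar>) = (\<lambda>x. ?I x * (C * \<bar>ln x\<bar> ^ k))"
      using C[of "1/2"] by (auto split: split_indicator simp: abs_mult power_abs)
    ultimately show ?thesis by simp
  qed
  have "(\<lambda>n. LINT x|lborel. ?I x * (\<theta> x * ?R n x)) \<longlonglongrightarrow>
     (LINT x|lborel. ?I x * (\<theta> x * (real (K + 1) * (- ln x) ^ K)))"
  proof (rule integral_dominated_convergence)
    show "(\<lambda>x. ?I x * (\<theta> x * (real (K + 1) * (- ln x) ^ K))) \<in> borel_measurable lborel" by measurable
    show "\<And>n. (\<lambda>x. ?I x * (\<theta> x * ?R n x)) \<in> borel_measurable lborel" by measurable
    have "integrable lborel (\<lambda>x. 4 * real (K + 1) * (?I x * (C * \<bar>ln x\<bar> ^ K)) +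
       4 * real (K + 1) / (ln 2)\<^sup>2 * (?I x * (C * \<bar>ln x\<bar> ^ (K + 2))) +
       (\<Sum>k<K. real (k + 1) * 2 ^ K) * (?I x * (C * \<bar>ln x\<bar> ^ K)))"
      by (intro Bochner_Integration.integrable_add integrable_mult_right domint)
    moreover have "(\<lambda>x. 4 * real (K + 1) * (?I x * (C * \<bar>ln x\<bar> ^ K)) +
       4 * real (K + 1) / (ln 2)\<^sup>2 * (?I x * (C * \<bar>ln x\<bar> ^ (K + 2))) +
       (\<Sum>k<K. real (k + 1) * 2 ^ K) * (?I x * (C * \<bar>ln x\<bar> ^ K))) = (\<lambda>x. ?I x * (C * kernel_dominator K (- ln x)))"
      by (auto simp: kernel_dominator_def algebra_simps split: split_indicator)
    ultimately show "integrable lborel (\<lambda>x. ?I x * (C * kernel_dominator K (- ln x)))" by simp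
    show "AE x in lborel. (\<lambda>n. ?I x * (\<theta> x * ?R n x)) \<longlonglongrightarrow> ?I x * (\<theta> x * (real (K + 1) * (- ln x) ^ K))"
    proof (rule AE_I2)
      fix x :: real
      show "(\<lambda>n. ?I x * (\<theta> x * ?R n x)) \<longlonglongrightarrow> ?I x * (\<theta> x * (real (K + 1) * (- ln x) ^ K))"
      proof (cases "x \<in> {0<..<1}")
        case True
        have lim: "filterlim ?L at_top sequentially" by real_asymp
        have "(\<lambda>n. ?L n ^ (K + 2) / (?L n - (- ln x))\<^sup>2 - ?S n x) \<longlonglongrightarrow> real (K + 1) * (- ln x) ^ K"
          by (rule filterlim_compose[OF kernel_tendsto lim])
        moreover have "(\<lambda>n. 2 / real (n + 4)) \<longlonglongrightarrow> 0" by real_asymp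
        then have "\<forall>\<^sub>F n in sequentially. 2 / real (n + 4) < x"
          using True by (intro order_tendstoD) auto
        then have "\<forall>\<^sub>F n in sequentially. ?L n ^ (K + 2) / (?L n - (- ln x))\<^sup>2 - ?S n x = ?R n x"
          by eventually_elim (use True in auto)
        ultimately have "(\<lambda>n. ?R n x) \<longlonglongrightarrow> real (K + 1) * (- ln x) ^ K"
          by (rule Lim_transform_eventually)
        then show ?thesis by (intro tendsto_intros)
      qed auto
    qed
    fix n
    show "AE x in lborel. norm (?I x * (\<theta> x * ?R n x)) \<le> ?I x * (C * kernel_dominator K (- ln x))"
    proof (rule AE_I2)
      fix x :: real
      show "norm (?I x * (\<theta> x * ?R n x)) \<le> ?I x * (C * kernel_dominator K (- ln x))"
      proof (cases "x \<in> {0<..<1}")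
        case True
        \<comment> \<open>In the variable \<tau> = - ln x the cutoff is exactly the border between
          the two domination lemmas.\<close>
        have iff: "2 / real (n + 4) \<le> x \<longleftrightarrow> - ln x \<le> ?L n - ln 2"
        proof -
          have "2 / real (n + 4) \<le> x \<longleftrightarrow> ln (2 / real (n + 4)) \<le> ln x"
            using True by (subst ln_le_cancel_iff) auto
          also have "\<dots> \<longleftrightarrow> - ln x \<le> ?L n - ln 2" by (subst ln_div) auto
          finally show ?thesis .
        qed
        have "2 * ln 2 = ln (2 ^ 2 :: real)" by (subst ln_realpow) auto
        also have "\<dots> \<le> ?L n" by (subst ln_le_cancel_iff) auto
        finally have L: "2 * ln 2 \<le> ?L n" .
        have "\<bar>?R n x\<bar> \<le> kernel_dominator K (- ln x)"
        proof (cases "- ln x \<le> ?L n - ln 2")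
          case True1: True
          then show ?thesis
            using kernel_le_dominator[of "- ln x" "?L n" K] True iff by auto
        next
          case False
          then show ?thesis
            using kernel_tail_le_dominator[of "?L n" "- ln x" K] True L iff by auto
        qed
        with C[OF True] have "\<bar>\<theta> x\<bar> * \<bar>?R n x\<bar> \<le> C * kernel_dominator K (- ln x)"
          by (intro mult_mono) auto
        then show ?thesis using True by (simp add: abs_mult)
      qed auto
    qed
  qed
  moreover have "(LINT x|lborel. ?I x * (\<theta> x * ?R n x)) =
      ?L n ^ (K + 2) * (LINT x:{2 / real (n + 4)..<1}|lborel. \<theta> x / (ln (real (n + 4) * x))\<^sup>2)" for n
  proof -
    let ?f = "\<lambda>x. ?J n x * (\<theta> x / (ln (real (n + 4) * x))\<^sup>2)"
    \<comment> \<open>Right of the cutoff the argument of the logarithm is at least 2, so the kernel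
      has no singularity there.\<close>
    have f: "integrable lborel ?f"
    proof (rule Bochner_Integration.integrable_bound)
      show "integrable lborel (\<lambda>x. ?J n x * (C / (ln 2)\<^sup>2))" by simp
      show "AE x in lborel. norm (?f x) \<le> norm (?J n x * (C / (ln 2)\<^sup>2))"
      proof (rule AE_I2)
        fix x :: real
        show "norm (?f x) \<le> norm (?J n x * (C / (ln 2)\<^sup>2))"
        proof (cases "x \<in> {2 / real (n + 4)..<1}")
          case True
          then have "2 \<le> real (n + 4) * x" by (simp add: field_simps)
          then have "(ln 2)\<^sup>2 \<le> (ln (real (n + 4) * x))\<^sup>2"
            by (intro power_mono) (subst ln_le_cancel_iff, auto)
          moreover have "x \<in> {0<..<1}" using True
            by (auto intro: less_le_trans[of 0 "2 / real (n + 4)"])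
          then have "\<bar>\<theta> x\<bar> \<le> \<bar>C\<bar>" using C by fastforce
          ultimately have "\<bar>\<theta> x\<bar> / (ln (real (n + 4) * x))\<^sup>2 \<le> \<bar>C\<bar> / (ln 2)\<^sup>2"
            by (intro frac_le) auto
          then show ?thesis using True by simp
        qed auto
      qed
    qed measurable
    have "(LINT x|lborel. ?I x * (\<theta> x * ?R n x)) =
      (LINT x|lborel. ?L n ^ (K + 2) * ?f x -
         (\<Sum>k<K. (real (k + 1) * (- 1) ^ k * ?L n ^ (K - k)) * (?I x * (\<theta> x * ln x ^ k))))"
    proof (intro Bochner_Integration.integral_cong refl)
      fix x :: real
      have "?I x * (\<theta> x * ?S n x) = (\<Sum>k<K. (real (k + 1) * (- 1) ^ k * ?L n ^ (K - k)) * (?I x * (\<theta> x * ln x ^ k)))"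
        unfolding sum_distrib_left
        by (intro sum.cong refl) (subst power_minus, simp)
      moreover have "?I x * (\<theta> x * (?J n x * (?L n ^ (K + 2) / (?L n - (- ln x))\<^sup>2))) = ?L n ^ (K + 2) * ?f x"
      proof (cases "x \<in> {2 / real (n + 4)..<1}")
        case True
        then have "0 < x" by (auto intro: less_le_trans[of 0 "2 / real (n + 4)"])
        then show ?thesis using True by (simp add: ln_mult)
      qed auto
      ultimately show "?I x * (\<theta> x * ?R n x) = ?L n ^ (K + 2) * ?f x -
         (\<Sum>k<K. (real (k + 1) * (- 1) ^ k * ?L n ^ (K - k)) * (?I x * (\<theta> x * ln x ^ k)))"
        by (simp add: right_diff_distrib)
    qed
    also have "\<dots> = ?L n ^ (K + 2) * (LINT x|lborel. ?f x) -
         (\<Sum>k<K. (real (k + 1) * (- 1) ^ k * ?L n ^ (K - k)) * (LINT x|lborel. ?I x * (\<theta> x * ln x ^ k)))"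
    proof -
      let ?c = "\<lambda>k. real (k + 1) * (- 1) ^ k * ?L n ^ (K - k)"
      have "integrable lborel (\<lambda>x. ?L n ^ (K + 2) * ?f x)"
        by (rule integrable_mult_right) (rule f)
      moreover have sint: "integrable lborel (\<lambda>x. ?c k * (?I x * (\<theta> x * ln x ^ k)))" for k
        by (rule integrable_mult_right) (rule lnint)
      moreover from sint have "integrable lborel (\<lambda>x. \<Sum>k<K. ?c k * (?I x * (\<theta> x * ln x ^ k)))"
        by (rule Bochner_Integration.integrable_sum)
      ultimately show ?thesis
        by (simp only: Bochner_Integration.integral_diff Bochner_Integration.integral_sum
            integral_mult_right_zero)
    qed
    also have "(\<Sum>k<K. (real (k + 1) * (- 1) ^ k * ?L n ^ (K - k)) * (LINT x|lborel. ?I x * (\<theta> x * ln x ^ k))) = 0"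
      using zero by (intro sum.neutral) (auto simp: set_lebesgue_integral_def)
    finally show ?thesis by (simp add: set_lebesgue_integral_def)
  qed
  moreover have "(LINT x|lborel. ?I x * (\<theta> x * (real (K + 1) * (- ln x) ^ K))) =
      real (K + 1) * (LINT x:{0<..<1}|lborel. \<theta> x * (- ln x) ^ K)"
    unfolding set_lebesgue_integral_def
    by (subst integral_mult_right_zero[symmetric]) (simp add: mult_ac)
  ultimately show "(\<lambda>n. ?L n ^ (K + 2) * (LINT x:{2 / real (n + 4)..<1}|lborel. \<theta> x / (ln (real (n + 4) * x))\<^sup>2))
    \<longlonglongrightarrow> real (K + 1) * (LINT x:{0<..<1}|lborel. \<theta> x * (- ln x) ^ K)"
    by simp
qed

section \<open>Comparison of the discounted sum with the kernel integral\<close>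

lemma log_discount_diff_has_integral:
  assumes "1 \<le> r" "1 \<le> n"
  shows "((\<lambda>x. 1 / (x * (ln (real n * x))\<^sup>2)) has_integral (log_discount r - log_discount (r + 1)))
    {real (r + 1) / real n..real (r + 2) / real n}"
proof -
  \<comment> \<open>The antiderivative is \<open>- 1 / ln (real n * x)\<close>. As
    \<open>D r\<close> is 1 / ln (1 + r), it corresponds to the point (r + 1)/n, which is why the
    cell is shifted by one against the rank.\<close>
  have "((\<lambda>x. 1 / (x * (ln (real n * x))\<^sup>2)) has_integral
     (- 1 / ln (real n * (real (r + 2) / real n)) - (- 1 / ln (real n * (real (r + 1) / real n)))))
    {real (r + 1) / real n..real (r + 2) / real n}"
  proof (rule fundamental_theorem_of_calculus)
    show "real (r + 1) / real n \<le> real (r + 2) / real n"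
      by (intro divide_right_mono) auto
    fix x assume x: "x \<in> {real (r + 1) / real n..real (r + 2) / real n}"
    have "0 < real n" using assms by simp
    then have nx: "real (r + 1) \<le> real n * x"
      using x by (simp add: pos_divide_le_eq mult.commute)
    then have "1 < real n * x" using assms by linarith
    then have "0 < ln (real n * x)" by (rule ln_gt_zero)
    moreover have "0 < x"
      using \<open>1 < real n * x\<close> \<open>0 < real n\<close> by (intro zero_less_mult_pos[of "real n" x]) auto
    ultimately have "((\<lambda>x. - 1 / ln (real n * x)) has_real_derivative 1 / (x * (ln (real n * x))\<^sup>2)) (at x)"
      using \<open>0 < real n\<close>
      by (auto intro!: derivative_eq_intros simp: power2_eq_square field_simps)
    then show "((\<lambda>x. - 1 / ln (real n * x)) has_vector_derivative 1 / (x * (ln (real n * x))\<^sup>2))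
        (at x within {real (r + 1) / real n..real (r + 2) / real n})"
      by (simp add: has_real_derivative_iff_has_vector_derivative has_vector_derivative_at_within)
  qed
  then show ?thesis
    using assms by (simp add: log_discount_def add.commute)
qed

lemma log_discount_antimono:
  assumes "1 \<le> r"
  shows "log_discount (r + 1) \<le> log_discount r"
  using assms unfolding log_discount_def by (intro frac_le) (auto simp: ln_gt_zero)

lemma log_discount_nonneg: "0 \<le> log_discount r"
  by (simp add: log_discount_def)

text \<open>Each drop of the discount is the mass of 1 / (x (ln (n x))^2) on one cell. Freezing
  \<Phi> at r/n, which is within 2/n of every point of that cell, costs at most 2 B / n times that
  mass, and the masses telescope.\<close>

lemma discounted_sum_eq_kernel_integral:
  fixes \<Phi> :: "real \<Rightarrow> real"
  assumes lip: "\<And>x y. \<bar>\<Phi> x - \<Phi> y\<bar> \<le> B * \<bar>x - y\<bar>"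
    and zero: "\<And>x. 1 \<le> x \<Longrightarrow> \<Phi> x = 0" and n: "1 \<le> n"
  shows "\<bar>(LINT x:{2 / real n..<1}|lborel. \<Phi> x / x / (ln (real n * x))\<^sup>2) -
    (\<Sum>r = 1..<n. (log_discount r - log_discount (r + 1)) * \<Phi> (real r / real n))\<bar>
    \<le> 2 * B / real n * log_discount 1"
proof -
  have "0 \<le> B" using lip[of 0 1] by simp
  have n0: "0 < real n" using n by simp
  have cont\<Phi>: "continuous_on S \<Phi>" for S
  proof (rule continuous_on_subset[OF _ subset_UNIV])
    have "B-lipschitz_on UNIV \<Phi>"
      using lip \<open>0 \<le> B\<close> by (auto simp: lipschitz_on_def dist_real_def)
    then show "continuous_on UNIV \<Phi>" by (rule lipschitz_on_continuous_on)
  qed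
  let ?w = "\<lambda>x. 1 / (x * (ln (real n * x))\<^sup>2)"
  let ?h = "\<lambda>x. \<Phi> x * ?w x"
  have pos: "0 < x" "1 < real n * x" "0 < ln (real n * x)" if "2 / real n \<le> x" for x
  proof -
    show "1 < real n * x" using that n0 by (simp add: field_simps)
    then show "0 < ln (real n * x)" by (rule ln_gt_zero)
    show "0 < x" using that n0 by (auto intro: less_le_trans[of 0 "2 / real n"])
  qed
  have cont: "continuous_on {a..b} ?h" if "2 / real n \<le> a" for a b
    using pos[OF order_trans[OF that]] n0
    by (intro continuous_intros cont\<Phi>) (fastforce dest: pos(3))+
  have cell: "\<bar>integral {real (r + 1) / real n..real (r + 2) / real n} ?h -
      (log_discount r - log_discount (r + 1)) * \<Phi> (real r / real n)\<bar>
      \<le> 2 * B / real n * (log_discount r - log_discount (r + 1))" if r: "1 \<le> r" for r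
  proof -
    let ?A = "{real (r + 1) / real n..real (r + 2) / real n}"
    have le: "2 / real n \<le> real (r + 1) / real n" using r by (intro divide_right_mono) auto
    note w = log_discount_diff_has_integral[OF r n]
    have wi: "?w integrable_on ?A" using w by blast
    have hi: "?h integrable_on ?A" by (rule integrable_continuous_real[OF cont[OF le]])
    have ci: "(\<lambda>x. \<Phi> (real r / real n) * ?w x) integrable_on ?A"
      by (rule integrable_on_mult_right[OF wi])
    have "integral ?A ?h - (log_discount r - log_discount (r + 1)) * \<Phi> (real r / real n) =
        integral ?A ?h - integral ?A (\<lambda>x. \<Phi> (real r / real n) * ?w x)"
      unfolding Henstock_Kurzweil_Integration.integral_mult_right integral_unique[OF w]
      by (simp add: mult.commute)
    also have "\<dots> = integral ?A (\<lambda>x. ?h x - \<Phi> (real r / real n) * ?w x)"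
      by (rule Henstock_Kurzweil_Integration.integral_diff[symmetric, OF hi ci])
    finally have "\<bar>integral ?A ?h - (log_discount r - log_discount (r + 1)) * \<Phi> (real r / real n)\<bar> =
        norm (integral ?A (\<lambda>x. ?h x - \<Phi> (real r / real n) * ?w x))" by simp
    also have "\<dots> \<le> integral ?A (\<lambda>x. 2 * B / real n * ?w x)"
    proof (rule integral_norm_bound_integral)
      show "(\<lambda>x. ?h x - \<Phi> (real r / real n) * ?w x) integrable_on ?A"
        by (rule Henstock_Kurzweil_Integration.integrable_diff[OF hi ci])
      show "(\<lambda>x. 2 * B / real n * ?w x) integrable_on ?A"
        by (rule integrable_on_mult_right[OF wi])
      fix x assume x: "x \<in> ?A"
      have "0 \<le> ?w x" using pos[of x] x le by auto
      have "\<bar>\<Phi> x - \<Phi> (real r / real n)\<bar> \<le> B * \<bar>x - real r / real n\<bar>" by (rule lip)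
      also have "\<dots> \<le> B * (2 / real n)"
      proof (intro mult_left_mono \<open>0 \<le> B\<close>)
        have "real r / real n \<le> real (r + 1) / real n" by (intro divide_right_mono) auto
        moreover have "real (r + 2) / real n = real r / real n + 2 / real n"
          by (simp add: add_divide_distrib)
        ultimately show "\<bar>x - real r / real n\<bar> \<le> 2 / real n" using x by auto
      qed
      finally have "\<bar>\<Phi> x - \<Phi> (real r / real n)\<bar> * ?w x \<le> 2 * B / real n * ?w x"
        using \<open>0 \<le> ?w x\<close> by (intro mult_right_mono) (auto simp: mult.commute[of B 2])
      moreover have "norm (?h x - \<Phi> (real r / real n) * ?w x) = \<bar>\<Phi> x - \<Phi> (real r / real n)\<bar> * ?w x"
        using \<open>0 \<le> ?w x\<close> by (simp only: left_diff_distrib[symmetric] real_norm_def abs_mult abs_of_nonneg)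
      ultimately show "norm (?h x - \<Phi> (real r / real n) * ?w x) \<le> 2 * B / real n * ?w x" by simp
    qed
    also have "\<dots> = 2 * B / real n * (log_discount r - log_discount (r + 1))"
      unfolding Henstock_Kurzweil_Integration.integral_mult_right integral_unique[OF w] ..
    finally show ?thesis .
  qed
  \<comment> \<open>The cells with r < m fill the interval from 2/n to (m + 1)/n; the error bound is
    kept in telescoped form so that each step just adds one cell.\<close>
  have "\<bar>integral {2 / real n..real (m + 1) / real n} ?h -
      (\<Sum>r = 1..<m. (log_discount r - log_discount (r + 1)) * \<Phi> (real r / real n))\<bar>
      \<le> 2 * B / real n * (log_discount 1 - log_discount m)" if "1 \<le> m" for m
    using that
  proof (induction m rule: dec_induct)
    case base
    then show ?case by simp
  next
    case (step m)
    have m: "1 \<le> m" using step by simp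
    have "integral {2 / real n..real (m + 1) / real n} ?h +
        integral {real (m + 1) / real n..real (m + 2) / real n} ?h =
        integral {2 / real n..real (m + 2) / real n} ?h"
    proof (rule Henstock_Kurzweil_Integration.integral_combine)
      show "2 / real n \<le> real (m + 1) / real n" using m by (intro divide_right_mono) auto
      show "real (m + 1) / real n \<le> real (m + 2) / real n" by (intro divide_right_mono) auto
      show "?h integrable_on {2 / real n..real (m + 2) / real n}"
        by (rule integrable_continuous_real[OF cont]) simp
    qed
    moreover have "(\<Sum>r = 1..<Suc m. (log_discount r - log_discount (r + 1)) * \<Phi> (real r / real n)) =
      (\<Sum>r = 1..<m. (log_discount r - log_discount (r + 1)) * \<Phi> (real r / real n)) +
      (log_discount m - log_discount (m + 1)) * \<Phi> (real m / real n)"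
      using m by simp
    moreover have "2 * B / real n * (log_discount 1 - log_discount (Suc m)) =
      2 * B / real n * (log_discount 1 - log_discount m) + 2 * B / real n * (log_discount m - log_discount (m + 1))"
      by (simp only: distrib_left[symmetric]) simp
    ultimately show ?case using step.IH cell[OF m] by simp
  qed
  from this[OF n] have "\<bar>integral {2 / real n..real (n + 1) / real n} ?h -
      (\<Sum>r = 1..<n. (log_discount r - log_discount (r + 1)) * \<Phi> (real r / real n))\<bar>
      \<le> 2 * B / real n * (log_discount 1 - log_discount n)" .
  moreover have "2 * B / real n * (log_discount 1 - log_discount n) \<le> 2 * B / real n * log_discount 1"
    using \<open>0 \<le> B\<close> log_discount_nonneg[of n] by (intro mult_left_mono) auto
  \<comment> \<open>The last cell overshoots 1 by 1/n, but \<Phi> vanishes from 1 on.\<close>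
  moreover have "integral {2 / real n..real (n + 1) / real n} ?h =
      (LINT x:{2 / real n..<1}|lborel. \<Phi> x / x / (ln (real n * x))\<^sup>2)"
  proof -
    have "set_integrable lborel {2 / real n..real (n + 1) / real n} ?h"
      by (intro borel_integrable_atLeastAtMost' cont) simp
    then have "integral {2 / real n..real (n + 1) / real n} ?h =
        (LINT x:{2 / real n..real (n + 1) / real n}|lborel. ?h x)"
      by (simp add: set_borel_integral_eq_integral)
    also have "\<dots> = (LINT x:{2 / real n..<1}|lborel. \<Phi> x / x / (ln (real n * x))\<^sup>2)"
      unfolding set_lebesgue_integral_def
    proof (intro Bochner_Integration.integral_cong refl)
      fix x :: real
      have "1 < real (n + 1) / real n" using n0 by simp
      then show "indicator {2 / real n..real (n + 1) / real n} x *\<^sub>R ?h x =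
          indicator {2 / real n..<1} x *\<^sub>R (\<Phi> x / x / (ln (real n * x))\<^sup>2)"
        using zero[of x] by (auto split: split_indicator)
    qed
    finally show ?thesis .
  qed
  ultimately show ?thesis by linarith
qed

text \<open>
  The exponent \<open>k\<close> is \<open>K + 2\<close>, where \<open>K\<close> is the order of the first nonzero logarithmic moment.
\<close>

lemma discounted_sum_asymptotics:
  fixes \<Phi> :: "real \<Rightarrow> real"
  assumes lip: "\<And>x y. \<bar>\<Phi> x - \<Phi> y\<bar> \<le> B * \<bar>x - y\<bar>"
    and zero: "\<Phi> 0 = 0" "\<And>x. 1 \<le> x \<Longrightarrow> \<Phi> x = 0"
    and x0: "x0 \<in> {0<..<1}" "\<Phi> x0 \<noteq> 0"
  obtains k c where "c \<noteq> 0"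
    "(\<lambda>n. ln (real n) ^ k * (\<Sum>r = 1..<n. (log_discount r - log_discount (r + 1)) * \<Phi> (real r / real n))) \<longlonglongrightarrow> c"
proof -
  have "0 \<le> B" using lip[of 0 1] by simp
  have "B-lipschitz_on UNIV \<Phi>"
    using lip \<open>0 \<le> B\<close> by (auto simp: lipschitz_on_def dist_real_def)
  then have cont: "continuous_on UNIV \<Phi>" by (rule lipschitz_on_continuous_on)
  then have [measurable]: "\<Phi> \<in> borel_measurable borel"
    by (rule borel_measurable_continuous_onI)
  have bd: "\<bar>\<Phi> x\<bar> \<le> B * x" if "x \<in> {0<..<1}" for x
    using lip[of x 0] zero(1) that by simp
  define K where "K = (LEAST k. (LINT x:{0<..<1}|lborel. \<Phi> x / x * ln x ^ k) \<noteq> 0)"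
  have K: "(LINT x:{0<..<1}|lborel. \<Phi> x / x * ln x ^ K) \<noteq> 0"
    unfolding K_def by (rule LeastI_ex[OF exists_nonzero_ln_moment[OF cont bd x0]])
  have least: "(LINT x:{0<..<1}|lborel. \<Phi> x / x * ln x ^ k) = 0" if "k < K" for k
    using not_less_Least[OF that[unfolded K_def]] by blast
  let ?c = "real (K + 1) * (LINT x:{0<..<1}|lborel. \<Phi> x / x * (- ln x) ^ K)"
  let ?I = "\<lambda>n. LINT x:{2 / real n..<1}|lborel. \<Phi> x / x / (ln (real n * x))\<^sup>2"
  let ?M = "\<lambda>n. \<Sum>r = 1..<n. (log_discount r - log_discount (r + 1)) * \<Phi> (real r / real n)"
  \<comment> \<open>Passing from \<open>ln x\<close> to \<open>- ln x\<close> can only change the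
    sign of the moment.\<close>
  have "(LINT x:{0<..<1}|lborel. \<Phi> x / x * (- ln x) ^ K) =
      (- 1) ^ K * (LINT x:{0<..<1}|lborel. \<Phi> x / x * ln x ^ K)"
    by (subst set_integral_mult_right[symmetric]) (subst power_minus, simp add: mult_ac)
  with K have c: "?c \<noteq> 0" by simp
  have "(\<lambda>n. ln (real n) ^ (K + 2) * ?I n) \<longlonglongrightarrow> ?c"
  proof (rule tendsto_ln_power_times_kernel_integral)
    show "\<bar>\<Phi> x / x\<bar> \<le> B" if "x \<in> {0<..<1}" for x
      using bd[OF that] that by (simp add: field_simps)
  qed (use least in auto)
  \<comment> \<open>Sum and integral differ by O(1/n), which is negligible against every power of 1
    / ln n.\<close>
  moreover have "(\<lambda>n. ln (real n) ^ (K + 2) * ?M n - ln (real n) ^ (K + 2) * ?I n) \<longlonglongrightarrow> 0"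
  proof (rule Lim_null_comparison)
    show "\<forall>\<^sub>F n in sequentially. norm (ln (real n) ^ (K + 2) * ?M n - ln (real n) ^ (K + 2) * ?I n) \<le>
        ln (real n) ^ (K + 2) * (2 * B / real n * log_discount 1)"
      using eventually_ge_at_top[of 1]
    proof eventually_elim
      case (elim n)
      then have "0 \<le> ln (real n)" by simp
      have "norm (ln (real n) ^ (K + 2) * ?M n - ln (real n) ^ (K + 2) * ?I n) =
          ln (real n) ^ (K + 2) * \<bar>?I n - ?M n\<bar>"
        using \<open>0 \<le> ln (real n)\<close>
        by (simp only: right_diff_distrib[symmetric] real_norm_def abs_mult abs_minus_commute) simp
      also have "\<dots> \<le> ln (real n) ^ (K + 2) * (2 * B / real n * log_discount 1)"
        using \<open>0 \<le> ln (real n)\<close>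
        by (intro mult_left_mono discounted_sum_eq_kernel_integral lip zero elim) auto
      finally show ?case .
    qed
    show "(\<lambda>n. ln (real n) ^ (K + 2) * (2 * B / real n * log_discount 1)) \<longlonglongrightarrow> 0"
      by real_asymp
  qed
  ultimately have "(\<lambda>n. ln (real n) ^ (K + 2) * ?I n + (ln (real n) ^ (K + 2) * ?M n - ln (real n) ^ (K + 2) * ?I n)) \<longlonglongrightarrow> ?c + 0"
    by (rule tendsto_add)
  then show thesis
    using that[OF c, of "K + 2"] by simp
qed

subsection \<open>DCG and the labels of the top items\<close>

lemma summation_by_parts:
  fixes a D :: "nat \<Rightarrow> real"
  shows "(\<Sum>r = 1..n. a (r - 1) * D r) =
    (\<Sum>r = 1..<n. (D r - D (r + 1)) * (\<Sum>i<r. a i)) + D n * (\<Sum>i<n. a i)"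
proof (induction n)
  case (Suc n)
  then show ?case
    by (cases "n = 0") (simp_all add: algebra_simps)
qed simp

lemma ranked_mset: "mset (ranked f S) = mset S"
  by (simp add: ranked_def)

lemma ranked_set: "set (ranked f S) = set S"
  by (simp add: ranked_def)

lemma ranked_length: "length (ranked f S) = length S"
  by (simp add: ranked_def)

definition top_labels :: "('a \<Rightarrow> real) \<Rightarrow> ('a \<times> real) list \<Rightarrow> nat \<Rightarrow> real" where
  "top_labels f S r = (\<Sum>i<r. snd (ranked f S ! i))"

lemma top_labels_eq_sum_list:
  assumes "r \<le> length S"
  shows "top_labels f S r = sum_list (map snd (take r (ranked f S)))"
  using assms
  by (simp add: top_labels_def sum_list_sum_nth ranked_length atLeast0LessThan)

lemma top_labels_length: "top_labels f S (length S) = sum_list (map snd S)"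
proof -
  have "sum_list (map snd (ranked f S)) = sum_mset (mset (map snd (ranked f S)))"
    by (simp only: sum_mset_sum_list)
  also have "\<dots> = sum_list (map snd S)"
    by (simp add: ranked_mset sum_mset_sum_list[symmetric] del: sum_mset_sum_list)
  finally show ?thesis
    by (simp add: top_labels_eq_sum_list ranked_length)
qed

lemma DCG_by_parts:
  "DCG D f S = (\<Sum>r = 1..<length S. (D r - D (r + 1)) * top_labels f S r) +
     D (length S) * sum_list (map snd S)"
  unfolding DCG_def using summation_by_parts[of "\<lambda>i. snd (ranked f S ! i)" D "length S"]
  by (simp add: top_labels_def[symmetric] top_labels_length)

text \<open>This allows a fixed rank to be traded for the random number of items above a
  threshold.\<close>

lemma top_labels_lipschitz:
  assumes lab: "\<And>z. z \<in> set S \<Longrightarrow> snd z \<in> {0..1}" and "r \<le> length S" "r' \<le> length S"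
  shows "\<bar>top_labels f S r - top_labels f S r'\<bar> \<le> \<bar>real r - real r'\<bar>"
proof -
  have *: "\<bar>top_labels f S m - top_labels f S k\<bar> \<le> \<bar>real m - real k\<bar>" if "k \<le> m" "m \<le> length S" for k m
  proof -
    have "top_labels f S m - top_labels f S k = (\<Sum>i = k..<m. snd (ranked f S ! i))"
      using that by (simp add: top_labels_def lessThan_atLeast0 sum_diff_nat_ivl)
    also have "\<bar>\<dots>\<bar> \<le> (\<Sum>i = k..<m. \<bar>snd (ranked f S ! i)\<bar>)" by (rule sum_abs)
    also have "\<dots> \<le> (\<Sum>i = k..<m. 1)"
    proof (rule sum_mono)
      fix i assume "i \<in> {k..<m}"
      then have "ranked f S ! i \<in> set S"
        using that nth_mem[of i "ranked f S"] by (simp add: ranked_length ranked_set)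
      then show "\<bar>snd (ranked f S ! i)\<bar> \<le> 1" using lab by fastforce
    qed
    finally show ?thesis using that by simp
  qed
  show ?thesis
    using *[of r r'] *[of r' r] assms by (cases "r \<le> r'") (auto simp: abs_minus_commute)
qed

text \<open>
  The items above a threshold of a monotone transform of the score are a prefix of the ranking,
  however ties are broken; so ties never have to be excluded.
\<close>

lemma top_labels_prefix:
  fixes G :: "real \<Rightarrow> real" and f :: "'a \<Rightarrow> real" and t :: real
  assumes "mono G"
  defines "U \<equiv> \<lambda>z. t < G (f (fst z))"
  shows "top_labels f S (length (filter U S)) = sum_list (map snd (filter U S))"
proof -
  let ?rs = "ranked f S"
  have "sorted (map (\<lambda>z. - f (fst z)) ?rs)"
    by (simp add: ranked_def)
  then have "sorted_wrt (\<lambda>z w. G (f (fst z)) \<ge> G (f (fst w))) ?rs"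
    unfolding sorted_map
    by (rule sorted_wrt_mono_rel[rotated]) (use \<open>mono G\<close> in \<open>auto simp: mono_def\<close>)
  then have "sorted (rev (map (\<lambda>z. G (f (fst z))) ?rs))"
    by (simp add: sorted_wrt_rev sorted_wrt_map)
  then have fil: "filter U ?rs = takeWhile U ?rs"
    unfolding U_def by (rule filter_equals_takeWhile_sorted_rev)
  have ms: "mset (filter U ?rs) = mset (filter U S)"
    by (simp add: ranked_mset)
  then have len: "length (filter U ?rs) = length (filter U S)"
    by (rule mset_eq_length)
  have "take (length (filter U S)) ?rs = filter U ?rs"
    unfolding len[symmetric] fil by (rule takeWhile_eq_take[symmetric])
  then have "top_labels f S (length (filter U S)) = sum_list (map snd (filter U ?rs))"
    by (simp add: top_labels_eq_sum_list)
  also have "\<dots> = sum_mset (image_mset snd (mset (filter U ?rs)))"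
    by (simp only: sum_mset_sum_list mset_map[symmetric])
  also have "\<dots> = sum_list (map snd (filter U S))"
    unfolding ms by (simp only: sum_mset_sum_list mset_map[symmetric])
  finally show ?thesis .
qed

text \<open>At the rank equal to the number of items above \<open>t\<close> there is no error, by
  \<open>top_labels_prefix\<close>; moving from there to \<open>r\<close> costs at most the distance
  of the ranks.\<close>

lemma top_labels_deviation:
  fixes G :: "real \<Rightarrow> real"
  assumes "mono G" and "\<And>z. z \<in> set S \<Longrightarrow> snd z \<in> {0..1}" and "r \<le> length S"
  shows "\<bar>top_labels f S r - sum_list (map snd (filter (\<lambda>z. t < G (f (fst z))) S))\<bar> \<le>
    \<bar>real (length (filter (\<lambda>z. t < G (f (fst z))) S)) - real r\<bar>"
  using top_labels_lipschitz[OF assms(2,3), of "length (filter (\<lambda>z. t < G (f (fst z))) S)" f]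
  by (simp add: top_labels_prefix[OF \<open>mono G\<close>] abs_minus_commute)

text \<open>The deterministic half of the concentration argument. Each ranking contributes two
  errors \<epsilon>, one from the rank shift and one from the label count, hence the factor 4. The
  boundary terms of \<open>DCG_by_parts\<close> are the same for both rankings and cancel; the
  weights D r - D (r + 1) telescope to at most \<open>D 1\<close>.\<close>

lemma DCG_difference_approx:
  fixes f\<^sub>0 f\<^sub>1 :: "'a \<Rightarrow> real" and G\<^sub>0 G\<^sub>1 :: "real \<Rightarrow> real" and A\<^sub>0 A\<^sub>1 :: "real \<Rightarrow> real"
  defines "U\<^sub>0 \<equiv> \<lambda>t z. t < G\<^sub>0 (f\<^sub>0 (fst z))" and "U\<^sub>1 \<equiv> \<lambda>t z. t < G\<^sub>1 (f\<^sub>1 (fst z))"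
  assumes mono: "mono G\<^sub>0" "mono G\<^sub>1"
    and lab: "\<And>z. z \<in> set S \<Longrightarrow> snd z \<in> {0..1}" and n: "length S = n" "0 < n"
    and D: "\<And>r. 1 \<le> r \<Longrightarrow> D (r + 1) \<le> D r" "\<And>r. 0 \<le> D r"
    and N\<^sub>0: "\<And>r. r \<le> n \<Longrightarrow> \<bar>real (length (filter (U\<^sub>0 (1 - real r / n)) S)) - real r\<bar> \<le> \<epsilon>"
    and N\<^sub>1: "\<And>r. r \<le> n \<Longrightarrow> \<bar>real (length (filter (U\<^sub>1 (1 - real r / n)) S)) - real r\<bar> \<le> \<epsilon>"
    and B\<^sub>0: "\<And>r. r \<le> n \<Longrightarrow> \<bar>sum_list (map snd (filter (U\<^sub>0 (1 - real r / n)) S)) - n * A\<^sub>0 (real r / n)\<bar> \<le> \<epsilon>"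
    and B\<^sub>1: "\<And>r. r \<le> n \<Longrightarrow> \<bar>sum_list (map snd (filter (U\<^sub>1 (1 - real r / n)) S)) - n * A\<^sub>1 (real r / n)\<bar> \<le> \<epsilon>"
  shows "\<bar>DCG D f\<^sub>0 S - DCG D f\<^sub>1 S -
      n * (\<Sum>r = 1..<n. (D r - D (r + 1)) * (A\<^sub>0 (real r / n) - A\<^sub>1 (real r / n)))\<bar> \<le> 4 * \<epsilon> * D 1"
proof -
  have "0 \<le> \<epsilon>" using N\<^sub>0[of 0] by linarith
  let ?e = "\<lambda>r. (top_labels f\<^sub>0 S r - n * A\<^sub>0 (real r / n)) - (top_labels f\<^sub>1 S r - n * A\<^sub>1 (real r / n))"
  have e: "\<bar>?e r\<bar> \<le> 4 * \<epsilon>" if "r \<le> n" for r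
  proof -
    have "\<bar>top_labels f\<^sub>0 S r - sum_list (map snd (filter (U\<^sub>0 (1 - real r / n)) S))\<bar> \<le> \<epsilon>"
      using top_labels_deviation[OF mono(1), of S r f\<^sub>0 "1 - real r / n"] lab n that N\<^sub>0[OF that]
      unfolding U\<^sub>0_def by auto
    moreover have "\<bar>top_labels f\<^sub>1 S r - sum_list (map snd (filter (U\<^sub>1 (1 - real r / n)) S))\<bar> \<le> \<epsilon>"
      using top_labels_deviation[OF mono(2), of S r f\<^sub>1 "1 - real r / n"] lab n that N\<^sub>1[OF that]
      unfolding U\<^sub>1_def by auto
    ultimately show ?thesis
      using B\<^sub>0[OF that] B\<^sub>1[OF that] by linarith
  qed
  have eq: "DCG D f\<^sub>0 S - DCG D f\<^sub>1 S -
      n * (\<Sum>r = 1..<n. (D r - D (r + 1)) * (A\<^sub>0 (real r / n) - A\<^sub>1 (real r / n))) =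
      (\<Sum>r = 1..<n. (D r - D (r + 1)) * ?e r)"
  proof -
    have "(\<Sum>r = 1..<n. (D r - D (r + 1)) * ?e r) =
      (\<Sum>r = 1..<n. (D r - D (r + 1)) * top_labels f\<^sub>0 S r - (D r - D (r + 1)) * top_labels f\<^sub>1 S r -
         n * ((D r - D (r + 1)) * (A\<^sub>0 (real r / n) - A\<^sub>1 (real r / n))))"
      by (intro sum.cong refl) (simp add: algebra_simps)
    then show ?thesis
      unfolding DCG_by_parts n(1) by (simp only: sum_subtractf sum_distrib_left)
  qed
  have "\<bar>\<Sum>r = 1..<n. (D r - D (r + 1)) * ?e r\<bar> \<le> (\<Sum>r = 1..<n. \<bar>(D r - D (r + 1)) * ?e r\<bar>)"
    by (rule sum_abs)
  also have "\<dots> \<le> (\<Sum>r = 1..<n. (D r - D (r + 1)) * (4 * \<epsilon>))"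
  proof (rule sum_mono)
    fix r assume "r \<in> {1..<n}"
    then have "0 \<le> D r - D (r + 1)" and "\<bar>?e r\<bar> \<le> 4 * \<epsilon>"
      using e[of r] D(1)[of r] by auto
    then show "\<bar>(D r - D (r + 1)) * ?e r\<bar> \<le> (D r - D (r + 1)) * (4 * \<epsilon>)"
      unfolding abs_mult by (metis abs_of_nonneg mult_left_mono)
  qed
  also have "\<dots> = (\<Sum>r = 1..<n. D r - D (r + 1)) * (4 * \<epsilon>)"
    by (simp only: sum_distrib_right)
  also have "(\<Sum>r = 1..<n. D r - D (r + 1)) = D 1 - D n"
    using sum_Suc_diff'[of 1 n "\<lambda>r. - D r"] n by simp
  also have "(D 1 - D n) * (4 * \<epsilon>) \<le> D 1 * (4 * \<epsilon>)"
    using D(2)[of n] \<open>0 \<le> \<epsilon>\<close> by (intro mult_right_mono) auto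
  finally show ?thesis unfolding eq by (simp only: mult_ac)
qed

text \<open>Every DCG lies between 0 and the common denominator. If that is 0, all DCGs are 0 and
  both strict inequalities fail; otherwise it is positive and can be cancelled.\<close>

lemma NDCG_less_iff_DCG_less:
  assumes lab: "\<And>z. z \<in> set S \<Longrightarrow> 0 \<le> snd z" and D: "\<And>r. 0 \<le> D r"
  shows "NDCG D f S < NDCG D f' S \<longleftrightarrow> DCG D f S < DCG D f' S"
proof -
  have le: "DCG D h S \<le> IDCG D S" for h
    unfolding IDCG_def by (rule Max_ge[OF finite_range_DCG]) simp
  have nonneg: "0 \<le> DCG D h S" for h
    unfolding DCG_def
  proof (intro sum_nonneg mult_nonneg_nonneg D)
    fix r assume "r \<in> {1..length S}"
    then have "r - 1 < length (ranked h S)" by (auto simp: ranked_length)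
    then have "ranked h S ! (r - 1) \<in> set S"
      by (metis nth_mem ranked_set)
    then show "0 \<le> snd (ranked h S ! (r - 1))" by (rule lab)
  qed
  show ?thesis
  proof (cases "IDCG D S = 0")
    case True
    then show ?thesis using le[of f] le[of f'] nonneg[of f] nonneg[of f'] by (simp add: NDCG_def)
  next
    case False
    then have "0 < IDCG D S" using le[of f] nonneg[of f] by linarith
    then show ?thesis by (simp add: NDCG_def divide_less_cancel)
  qed
qed

section \<open>Measurability of the ranking of a random sample\<close>

lemma map_insort_key: "map h (insort_key (k \<circ> h) x xs) = insort_key k (h x) (map h xs)"
  by (induction xs) auto

lemma map_sort_key: "map h (sort_key (k \<circ> h) xs) = sort_key k (map h xs)"
  by (induction xs) (simp_all add: map_insort_key[unfolded comp_def] comp_def)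

text \<open>Sorting indices instead of items turns the ranking into a random variable with countably
  many values, whatever the instance space is.\<close>

lemma ranked_map:
  "ranked f (map \<omega> is) = map \<omega> (sort_key (\<lambda>i. - f (fst (\<omega> i))) is)"
  using map_sort_key[of \<omega> "\<lambda>z. - f (fst z)" "is"] by (simp add: ranked_def comp_def)

lemma measurable_insort_key:
  fixes k :: "'w \<Rightarrow> 'i::countable \<Rightarrow> real"
  assumes [measurable]: "\<And>i. (\<lambda>\<omega>. k \<omega> i) \<in> borel_measurable M"
  shows "(\<lambda>\<omega>. insort_key (k \<omega>) x ys) \<in> measurable M (count_space UNIV)"
proof (induction ys)
  case (Cons y ys)
  have "(\<lambda>\<omega>. y # insort_key (k \<omega>) x ys) \<in> measurable M (count_space UNIV)"
    by (rule measurable_compose[OF Cons]) simp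
  then show ?case by simp
qed simp

lemma measurable_sort_key:
  fixes k :: "'w \<Rightarrow> 'i::countable \<Rightarrow> real"
  assumes k: "\<And>i. (\<lambda>\<omega>. k \<omega> i) \<in> borel_measurable M"
  shows "(\<lambda>\<omega>. sort_key (k \<omega>) xs) \<in> measurable M (count_space UNIV)"
proof (induction xs)
  case (Cons x xs)
  show ?case
    using measurable_compose_countable[where f = "\<lambda>ys \<omega>. insort_key (k \<omega>) x ys", OF measurable_insort_key[OF k] Cons]
    by simp
qed simp

text \<open>
  Measurability is essential: a non-measurable event would have measure 0 in the definition of
  distinguishability.
\<close>

lemma measurable_DCG_sample:
  assumes [measurable]: "(\<lambda>z. f (fst z)) \<in> borel_measurable P" "snd \<in> borel_measurable P"
  shows "(\<lambda>\<omega>. DCG D f (map \<omega> [0..<n])) \<in> borel_measurable (\<Pi>\<^sub>M i\<in>(UNIV :: nat set). P)"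
proof -
  let ?M = "\<Pi>\<^sub>M i\<in>(UNIV :: nat set). P"
  let ?s = "\<lambda>\<omega>. sort_key (\<lambda>i. - f (fst (\<omega> i))) [0..<n]"
  have s: "?s \<in> measurable ?M (count_space UNIV)"
    by (rule measurable_sort_key) measurable
  \<comment> \<open>The index of the item at a given position is random but discrete, so it is
    enough to treat each fixed index, where the map is a coordinate followed by
    \<open>snd\<close>.\<close>
  have "(\<lambda>\<omega>. snd (\<omega> (?s \<omega> ! j))) \<in> borel_measurable ?M" for j
  proof -
    have "(\<lambda>\<omega>. ?s \<omega> ! j) \<in> measurable ?M (count_space UNIV)"
      by (rule measurable_compose[OF s]) simp
    then show ?thesis
      by (rule measurable_compose_countable[rotated]) measurable
  qed
  then have "(\<lambda>\<omega>. \<Sum>r = 1..n. snd (\<omega> (?s \<omega> ! (r - 1))) * D r) \<in> borel_measurable ?M"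
    by (intro borel_measurable_sum borel_measurable_times) auto
  also have "(\<lambda>\<omega>. \<Sum>r = 1..n. snd (\<omega> (?s \<omega> ! (r - 1))) * D r) = (\<lambda>\<omega>. DCG D f (map \<omega> [0..<n]))"
  proof
    fix \<omega> :: "nat \<Rightarrow> 'a \<times> real"
    have "snd (\<omega> (?s \<omega> ! (r - 1))) = snd (map \<omega> (?s \<omega>) ! (r - 1))" if "r \<in> {1..n}" for r
    proof -
      have "r - 1 < n" using that by auto
      then show ?thesis by simp
    qed
    then show "(\<Sum>r = 1..n. snd (\<omega> (?s \<omega> ! (r - 1))) * D r) = DCG D f (map \<omega> [0..<n])"
      by (simp only: DCG_def ranked_map length_map length_upt diff_zero cong: sum.cong)
  qed
  finally show ?thesis .
qed

subsection \<open>Uniformity of the canonical version and concentration\<close>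

lemma Hoeffding_iid_sequence:
  fixes h :: "'b \<Rightarrow> real"
  assumes "prob_space P" and h [measurable]: "h \<in> borel_measurable P"
    and bd: "\<And>z. z \<in> space P \<Longrightarrow> h z \<in> {0..1}" and "0 < n" "0 \<le> \<epsilon>"
  shows "\<P>(\<omega> in (\<Pi>\<^sub>M i\<in>(UNIV :: nat set). P). \<bar>(\<Sum>i<n. h (\<omega> i)) - n * (LINT z|P. h z)\<bar> \<ge> \<epsilon>)
    \<le> 2 * exp (- 2 * \<epsilon>\<^sup>2 / n)"
proof -
  let ?M = "\<Pi>\<^sub>M i\<in>(UNIV :: nat set). P"
  interpret M: prob_space ?M by (rule prob_space_PiM) (rule assms(1))
  have comp: "distr ?M P (\<lambda>\<omega>. \<omega> i) = P" for i :: nat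
    using distr_PiM_component[of UNIV "\<lambda>_. P" i] assms(1) by simp
  \<comment> \<open>Coordinates are independent because their joint law is the product measure
    itself.\<close>
  have "M.indep_vars (\<lambda>_. P) (\<lambda>i \<omega>. \<omega> i) UNIV"
    by (subst M.indep_vars_iff_distr_eq_PiM') (simp_all add: comp restrict_UNIV)
  then have "M.indep_vars (\<lambda>_. P) (\<lambda>i \<omega>. \<omega> i) {..<n}"
    by (rule M.indep_vars_subset) simp
  then have ind: "M.indep_vars (\<lambda>_. borel) (\<lambda>i \<omega>. h (\<omega> i)) {..<n}"
    by (rule M.indep_vars_compose2) simp
  have dist: "distr ?M borel (\<lambda>\<omega>. h (\<omega> i)) = distr P borel h" for i :: nat
    using distr_distr[of h P borel "\<lambda>\<omega>. \<omega> i" ?M] by (simp add: comp comp_def)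
  have ex: "M.expectation (\<lambda>\<omega>. h (\<omega> 0)) = (LINT z|P. h z)"
    using integral_distr[of "\<lambda>\<omega>. \<omega> 0" ?M P h] by (simp add: comp)
  have ae: "AE \<omega> in ?M. h (\<omega> 0) \<in> {0..1}"
    by (rule AE_I2) (auto simp: space_PiM intro!: bd[simplified])
  interpret H: Hoeffding_ineq_iid ?M "{..<n}" "\<lambda>i \<omega>. h (\<omega> i)" "\<lambda>\<omega>. h (\<omega> 0)" 0 1 "M.expectation (\<lambda>\<omega>. h (\<omega> 0))"
  proof unfold_locales
    show "finite {..<n}" by simp
    show "M.indep_vars (\<lambda>_. borel) (\<lambda>i \<omega>. h (\<omega> i)) {..<n}" by (rule ind)
    show "distr ?M borel (\<lambda>\<omega>. h (\<omega> i)) = distr ?M borel (\<lambda>\<omega>. h (\<omega> 0))" for i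
      unfolding dist ..
    show "(\<lambda>\<omega>. h (\<omega> 0)) \<in> borel_measurable ?M" by measurable
    show "AE \<omega> in ?M. h (\<omega> 0) \<in> {0..1}" by (rule ae)
  qed
  show ?thesis
    using H.Hoeffding_ineq_abs_ge[OF \<open>0 \<le> \<epsilon>\<close> zero_less_one] \<open>0 < n\<close> unfolding ex
    by (simp add: lessThan_empty_iff)
qed

text \<open>The probability integral transform. Without atoms the distribution function is
  continuous and attains every level in (0,1), so sublevel sets of the canonical version can be
  compared with sets {f \<le> t}. For the upper bound the comparison is made at levels
  \<open>u > s\<close>, then \<open>u\<close> tends to \<open>s\<close>, because the distribution
  function may be flat at level \<open>s\<close>.\<close>

lemma prob_canonical_version_le:
  assumes "prob_space Q" and [measurable]: "f \<in> borel_measurable Q"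
    and atom: "\<And>t. \<P>(x in Q. f x = t) = 0" and s: "s \<in> {0..1}"
  shows "\<P>(x in Q. canonical_version Q f x \<le> s) = s"
proof -
  interpret Q: prob_space Q by fact
  let ?R = "distr Q borel f"
  interpret R: real_distribution ?R by simp
  have G: "canonical_version Q f x = cdf ?R (f x)" for x
    by (auto simp: canonical_version_def cdf_def measure_distr vimage_def intro!: arg_cong[where f = "measure Q"])
  have cont: "isCont (cdf ?R) t" for t
    using atom[of t] by (subst R.isCont_cdf)
      (simp add: measure_distr vimage_def Int_def conj_commute)
  have hit: "\<exists>t. cdf ?R t = u" if "0 < u" "u < 1" for u
  proof -
    obtain a where a: "cdf ?R a < u"
      using order_tendstoD(2)[OF R.cdf_lim_at_bot \<open>0 < u\<close>] by (auto simp: eventually_at_bot_linorder)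
    obtain b where b: "u < cdf ?R b"
      using order_tendstoD(1)[OF R.cdf_lim_at_top_prob \<open>u < 1\<close>] by (auto simp: eventually_at_top_linorder)
    have "a \<le> b" using a b R.cdf_nondecreasing[of b a] by linarith
    then show ?thesis
      using IVT[of "cdf ?R" a u b] a b cont by auto
  qed
  have cdfQ: "cdf ?R t = \<P>(x in Q. f x \<le> t)" for t
    by (auto simp: cdf_def measure_distr vimage_def intro!: arg_cong[where f = "measure Q"])
  have meas: "{x \<in> space Q. canonical_version Q f x \<le> u} \<in> sets Q" for u
  proof -
    have "mono (cdf ?R)" by (auto simp: mono_def R.cdf_nondecreasing)
    then have [measurable]: "cdf ?R \<in> borel_measurable borel" by (rule borel_measurable_mono)
    show ?thesis unfolding G by measurable
  qed
  have up: "\<P>(x in Q. canonical_version Q f x \<le> s) \<le> u" if "s < u" "u < 1" for u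
  proof -
    obtain t where t: "cdf ?R t = u" using hit[of u] s \<open>s < u\<close> \<open>u < 1\<close> by auto
    have "\<P>(x in Q. canonical_version Q f x \<le> s) \<le> \<P>(x in Q. f x \<le> t)"
    proof (intro Q.finite_measure_mono)
      show "{x \<in> space Q. canonical_version Q f x \<le> s} \<subseteq> {x \<in> space Q. f x \<le> t}"
      proof safe
        fix x assume "canonical_version Q f x \<le> s"
        then have "cdf ?R (f x) < cdf ?R t" using t \<open>s < u\<close> by (simp add: G)
        then show "f x \<le> t" using R.cdf_nondecreasing[of t "f x"] by linarith
      qed
    qed measurable
    then show ?thesis using t by (simp add: cdfQ)
  qed
  \<comment> \<open>The intermediate value argument reaches only levels strictly between 0 and 1;
    the endpoints are settled directly.\<close>
  have lo: "s \<le> \<P>(x in Q. canonical_version Q f x \<le> s)"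
  proof (cases "s = 0 \<or> s = 1")
    case True
    moreover have "\<P>(x in Q. canonical_version Q f x \<le> 1) = 1"
      using Q.prob_space by (simp add: canonical_version_def)
    ultimately show ?thesis by auto
  next
    case False
    then obtain t where t: "cdf ?R t = s" using hit[of s] s by auto
    have "\<P>(x in Q. f x \<le> t) \<le> \<P>(x in Q. canonical_version Q f x \<le> s)"
      by (intro Q.finite_measure_mono meas) (auto simp: G t[symmetric] intro: R.cdf_nondecreasing)
    then show ?thesis using t by (simp add: cdfQ)
  qed
  have "\<P>(x in Q. canonical_version Q f x \<le> s) \<le> s"
  proof (cases "s = 1")
    case False
    show ?thesis
    proof (rule dense_ge_bounded)
      show "s < 1" using False s by simp
    qed (rule up)
  qed simp
  with lo show ?thesis by simp
qed

section \<open>One ranking function: uniform canonical score and mass of positives at the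
  top\<close>

locale ranking_model = prob_space P
  for MX :: "'a measure" and P :: "('a \<times> real) measure" and f :: "'a \<Rightarrow> real" and g :: "real \<Rightarrow> real" +
  assumes sets_P: "sets P = sets (MX \<Otimes>\<^sub>M count_space {0, 1})"
    and score_measurable: "f \<in> borel_measurable MX"
    and no_ties: "\<And>t. \<P>(x in distr P MX fst. f x = t) = 0"
    and label_prob: "cond_label_prob MX P f g"
begin

definition score_cdf :: "real \<Rightarrow> real" where
  "score_cdf t = \<P>(x in distr P MX fst. f x \<le> t)"

abbreviation cscore :: "'a \<times> real \<Rightarrow> real" where
  "cscore z \<equiv> score_cdf (f (fst z))"

text \<open>The function called A in the overview; n times its value at r/n is the expected number
  of positives above the threshold 1 - r/n.\<close>

definition top_positives :: "real \<Rightarrow> real" where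
  "top_positives x = \<P>(z in P. snd z = 1 \<and> 1 - x < cscore z)"

lemma canonical_version_eq: "canonical_version (distr P MX fst) f x = score_cdf (f x)"
  by (simp add: canonical_version_def score_cdf_def)

lemma measurable_fst_P [measurable]: "fst \<in> measurable P MX"
  by (subst measurable_cong_sets[OF sets_P refl]) simp

lemma measurable_snd_P [measurable]: "snd \<in> borel_measurable P"
proof -
  have "snd \<in> measurable P (count_space {0, 1})"
    by (subst measurable_cong_sets[OF sets_P refl]) simp
  then show ?thesis by (rule measurable_compose) simp
qed

lemma label_cases: "z \<in> space P \<Longrightarrow> snd z \<in> {0, 1}"
proof -
  have "space P = space MX \<times> {0, 1}"
    unfolding sets_eq_imp_space_eq[OF sets_P] space_pair_measure space_count_space ..
  then show "z \<in> space P \<Longrightarrow> snd z \<in> {0, 1}" by (metis mem_Times_iff)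
qed

lemma prob_space_marginal: "prob_space (distr P MX fst)"
  by (rule prob_space_distr[OF measurable_fst_P])

lemma mono_score_cdf: "mono score_cdf"
proof
  fix s t :: real assume "s \<le> t"
  interpret Q: prob_space "distr P MX fst" by (rule prob_space_marginal)
  have [measurable]: "f \<in> borel_measurable (distr P MX fst)"
    using score_measurable by simp
  have "{x \<in> space (distr P MX fst). f x \<le> t} \<in> sets (distr P MX fst)" by measurable
  then show "score_cdf s \<le> score_cdf t"
    unfolding score_cdf_def using \<open>s \<le> t\<close> by (intro Q.finite_measure_mono) auto
qed

lemma measurable_score [measurable]: "(\<lambda>z. f (fst z)) \<in> borel_measurable P"
  by (rule measurable_compose[OF measurable_fst_P score_measurable])

lemma measurable_cscore [measurable]: "cscore \<in> borel_measurable P"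
  by (rule measurable_compose[OF measurable_score borel_measurable_mono[OF mono_score_cdf]])

lemma cscore_range: "cscore z \<in> {0..1}"
proof -
  interpret Q: prob_space "distr P MX fst" by (rule prob_space_marginal)
  show ?thesis by (simp add: score_cdf_def)
qed

text \<open>Uniformity of the canonical score, which rests on \<open>no_ties\<close>. The clamped
  form covers all real \<open>x\<close>, so that \<open>top_positives\<close> is Lipschitz on the
  whole line and constant from 1 on, as the comparison with the integral requires.\<close>

lemma prob_cscore_gt: "\<P>(z in P. 1 - x < cscore z) = max 0 (min 1 x)"
proof (cases "0 \<le> x \<and> x \<le> 1")
  case True
  have [measurable]: "(\<lambda>x. score_cdf (f x)) \<in> borel_measurable MX"
    by (rule measurable_compose[OF score_measurable borel_measurable_mono[OF mono_score_cdf]])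
  have "\<P>(z in P. cscore z \<le> 1 - x) = \<P>(x' in distr P MX fst. score_cdf (f x') \<le> 1 - x)"
  proof (subst measure_distr)
    show "{x' \<in> space (distr P MX fst). score_cdf (f x') \<le> 1 - x} \<in> sets MX"
      unfolding space_distr by measurable
    show "\<P>(z in P. cscore z \<le> 1 - x) =
        prob (fst -` {x' \<in> space (distr P MX fst). score_cdf (f x') \<le> 1 - x} \<inter> space P)"
      using measurable_space[OF measurable_fst_P] by (intro arg_cong[where f = prob]) auto
  qed simp
  also have "\<dots> = 1 - x"
    using prob_canonical_version_le[OF prob_space_marginal _ no_ties, of "1 - x"] True score_measurable
    by (simp add: canonical_version_eq)
  finally have "\<P>(z in P. cscore z \<le> 1 - x) = 1 - x" .
  moreover have "\<P>(z in P. \<not> cscore z \<le> 1 - x) = 1 - \<P>(z in P. cscore z \<le> 1 - x)"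
    by (rule prob_neg) measurable
  ultimately show ?thesis using True by (simp add: not_le)
next
  case False
  show ?thesis
  proof (cases "x < 0")
    case True
    have e: "{z \<in> space P. 1 - x < cscore z} = {}"
    proof -
      have "\<not> 1 - x < cscore z" for z using cscore_range[of z] True by auto
      then show ?thesis by blast
    qed
    show ?thesis unfolding e using True by simp
  next
    case nneg: False
    have e: "{z \<in> space P. 1 - x < cscore z} = space P"
    proof -
      have "1 - x < cscore z" for z using cscore_range[of z] False nneg by auto
      then show ?thesis by blast
    qed
    show ?thesis unfolding e using False nneg prob_space by simp
  qed
qed

lemma prob_cscore_between:
  assumes "0 \<le> s" "s \<le> t" "t \<le> 1"
  shows "\<P>(z in P. s < cscore z \<and> cscore z \<le> t) = t - s"
proof -
  have "\<P>(z in P. s < cscore z \<and> cscore z \<le> t) =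
      prob ({z \<in> space P. s < cscore z} - {z \<in> space P. t < cscore z})"
    by (intro arg_cong[where f = prob]) auto
  also have "\<dots> = \<P>(z in P. s < cscore z) - \<P>(z in P. t < cscore z)"
    using assms by (intro finite_measure_Diff) auto
  also have "\<dots> = t - s"
    using prob_cscore_gt[of "1 - s"] prob_cscore_gt[of "1 - t"] assms by simp
  finally show ?thesis .
qed

lemma top_positives_diff:
  assumes "s \<le> t"
  shows "top_positives (1 - s) - top_positives (1 - t) =
    \<P>(z in P. snd z = 1 \<and> s < cscore z \<and> cscore z \<le> t)"
proof -
  have "\<P>(z in P. snd z = 1 \<and> s < cscore z \<and> cscore z \<le> t) =
      prob ({z \<in> space P. snd z = 1 \<and> s < cscore z} - {z \<in> space P. snd z = 1 \<and> t < cscore z})"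
    by (intro arg_cong[where f = prob]) auto
  also have "\<dots> = \<P>(z in P. snd z = 1 \<and> s < cscore z) - \<P>(z in P. snd z = 1 \<and> t < cscore z)"
    using assms by (intro finite_measure_Diff) auto
  also have "\<dots> = top_positives (1 - s) - top_positives (1 - t)"
    by (simp add: top_positives_def)
  finally show ?thesis by simp
qed

lemma top_positives_lipschitz: "\<bar>top_positives x - top_positives y\<bar> \<le> \<bar>x - y\<bar>"
proof -
  have *: "\<bar>top_positives x - top_positives y\<bar> \<le> \<bar>x - y\<bar>" if "y \<le> x" for x y
  proof -
    have "top_positives x - top_positives y = \<P>(z in P. snd z = 1 \<and> 1 - x < cscore z \<and> cscore z \<le> 1 - y)"
      using top_positives_diff[of "1 - x" "1 - y"] that by simp
    also have "\<dots> \<le> prob ({z \<in> space P. 1 - x < cscore z} - {z \<in> space P. 1 - y < cscore z})"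
      by (intro finite_measure_mono) auto
    also have "\<dots> = \<P>(z in P. 1 - x < cscore z) - \<P>(z in P. 1 - y < cscore z)"
      using that by (intro finite_measure_Diff) auto
    also have "\<dots> \<le> x - y"
      unfolding prob_cscore_gt using that by auto
    finally have "top_positives x - top_positives y \<le> x - y" .
    moreover have "0 \<le> top_positives x - top_positives y"
      using top_positives_diff[of "1 - x" "1 - y"] that by simp
    ultimately show ?thesis by simp
  qed
  show ?thesis
    using *[of x y] *[of y x] by (cases "y \<le> x") (auto simp: abs_minus_commute)
qed

lemma top_positives_0: "top_positives 0 = 0"
proof -
  have "top_positives 0 \<le> \<P>(z in P. 1 - 0 < cscore z)"
    unfolding top_positives_def by (intro finite_measure_mono) auto
  then show ?thesis
    using prob_cscore_gt[of 0] by (simp add: top_positives_def measure_le_0_iff)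
qed

lemma top_positives_ge_1:
  assumes "1 \<le> x"
  shows "top_positives x = \<P>(z in P. snd z = 1)"
proof -
  have "\<P>(z in P. 1 - x < cscore z) = 1"
    using assms by (simp add: prob_cscore_gt)
  then have "AE z in P. 1 - x < cscore z"
    by (subst (asm) prob_Collect_eq_1) auto
  then show ?thesis
    unfolding top_positives_def by (intro finite_measure_eq_AE) auto
qed

text \<open>The event s < F(X) \<le> t belongs to the sigma-algebra generated by the canonical score
  F(X) and has mass t - s. On it the indicator of a positive label may be replaced by its
  conditional expectation g(F(X)), so bounds on \<open>g\<close> over the interval bound the
  increment.\<close>

lemma cond_label_prob_interval:
  assumes "0 \<le> s" "s \<le> t" "t \<le> 1"
  shows "(\<And>u. u \<in> {s..t} \<Longrightarrow> g u \<le> q) \<Longrightarrow> top_positives (1 - s) - top_positives (1 - t) \<le> q * (t - s)"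
    and "(\<And>u. u \<in> {s..t} \<Longrightarrow> q \<le> g u) \<Longrightarrow> q * (t - s) \<le> top_positives (1 - s) - top_positives (1 - t)"
proof -
  let ?V = "vimage_algebra (space P) cscore borel"
  let ?Y = "indicator {z \<in> space P. snd z = 1} :: 'a \<times> real \<Rightarrow> real"
  let ?E = "{z \<in> space P. s < cscore z \<and> cscore z \<le> t}"
  have "subalgebra P ?V"
    by (auto simp: subalgebra_def sets_vimage_algebra2)
  then interpret V: finite_measure_subalgebra P ?V
    by unfold_locales
  have E: "?E \<in> sets ?V"
  proof -
    have "cscore -` {s<..t} \<inter> space P \<in> sets ?V" by (rule in_vimage_algebra) simp
    moreover have "cscore -` {s<..t} \<inter> space P = ?E" by auto
    ultimately show ?thesis by simp
  qed
  have [measurable]: "?E \<in> sets P" by measurable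
  have "{z \<in> space P. snd z = 1} \<in> sets P" by measurable
  then have Yint: "integrable P ?Y"
    by (intro integrable_real_indicator) (simp_all add: emeasure_eq_measure)
  have ae: "AE z in P. real_cond_exp P ?V ?Y z = g (cscore z)"
    using label_prob by (simp add: cond_label_prob_def canonical_version_eq)
  have "top_positives (1 - s) - top_positives (1 - t) = prob ({z \<in> space P. snd z = 1} \<inter> ?E)"
    unfolding top_positives_diff[OF \<open>s \<le> t\<close>] by (intro arg_cong[where f = prob]) auto
  also have "\<dots> = (LINT z:?E|P. ?Y z)"
    by (simp add: set_lebesgue_integral_def indicator_inter_arith[symmetric] Int_commute)
  also have "\<dots> = (LINT z:?E|P. real_cond_exp P ?V ?Y z)"
    by (rule V.real_cond_exp_intA[OF Yint E])
  finally have eq: "top_positives (1 - s) - top_positives (1 - t) = (LINT z:?E|P. real_cond_exp P ?V ?Y z)" .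
  have cint: "set_integrable P ?E (real_cond_exp P ?V ?Y)"
    unfolding set_integrable_def
    by (intro integrable_mult_indicator V.real_cond_exp_int(1) Yint) simp
  have qint: "set_integrable P ?E (\<lambda>_. q)"
    unfolding set_integrable_def by (intro integrable_mult_indicator) auto
  have q: "(LINT z:?E|P. q) = q * (t - s)"
    using prob_cscore_between[OF assms] by (simp add: set_lebesgue_integral_def)
  show "top_positives (1 - s) - top_positives (1 - t) \<le> q * (t - s)"
    if "\<And>u. u \<in> {s..t} \<Longrightarrow> g u \<le> q"
    unfolding eq q[symmetric]
  proof (rule set_integral_mono_AE[OF cint qint])
    show "AE z \<in> ?E in P. real_cond_exp P ?V ?Y z \<le> q"
      using ae by eventually_elim (use that in auto)
  qed
  show "q * (t - s) \<le> top_positives (1 - s) - top_positives (1 - t)"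
    if "\<And>u. u \<in> {s..t} \<Longrightarrow> q \<le> g u"
    unfolding eq q[symmetric]
  proof (rule set_integral_mono_AE[OF qint cint])
    show "AE z \<in> ?E in P. q \<le> real_cond_exp P ?V ?Y z"
      using ae by eventually_elim (use that in auto)
  qed
qed

end

subsection \<open>Consistent distinguishability\<close>

lemma length_filter_sample:
  "real (length (filter U (map \<omega> [0..<n]))) = (\<Sum>i<n. of_bool (U (\<omega> i)))"
  by (induction n) simp_all

lemma sum_labels_filter_sample:
  fixes \<omega> :: "nat \<Rightarrow> 'a \<times> real"
  shows "sum_list (map snd (filter U (map \<omega> [0..<n]))) = (\<Sum>i<n. snd (\<omega> i) * of_bool (U (\<omega> i)))"
  by (induction n) simp_all

section \<open>Union bound over all large sample sizes and its negligible tail\<close>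

lemma (in prob_space) prob_all_ge_lower_bound:
  assumes meas: "\<And>n. {\<omega> \<in> space M. W n \<omega>} \<in> events"
    and bound: "\<And>n. N \<le> n \<Longrightarrow> \<P>(\<omega> in M. \<not> W n \<omega>) \<le> a n" and "summable a"
  shows "1 - (\<Sum>n. a (n + N)) \<le> \<P>(\<omega> in M. \<forall>n\<ge>N. W n \<omega>)"
proof -
  note [measurable] = meas
  have m: "{\<omega> \<in> space M. \<not> W n \<omega>} \<in> events" for n by measurable
  have sa: "summable (\<lambda>n. a (n + N))"
    using \<open>summable a\<close> by (rule summable_ignore_initial_segment)
  have sp: "summable (\<lambda>n. \<P>(\<omega> in M. \<not> W (n + N) \<omega>))"
    by (rule summable_comparison_test'[OF sa, of 0]) (use bound in auto)
  \<comment> \<open>Re-indexing by \<open>n + N\<close> makes the failure event a countable union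
    over all naturals, to which the bound applies without exception.\<close>
  have "\<P>(\<omega> in M. \<not> (\<forall>n\<ge>N. W n \<omega>)) = prob (\<Union>n. {\<omega> \<in> space M. \<not> W (n + N) \<omega>})"
    by (intro arg_cong[where f = prob]) (force simp: le_iff_add add.commute)
  also have "\<dots> \<le> (\<Sum>n. \<P>(\<omega> in M. \<not> W (n + N) \<omega>))"
    by (rule finite_measure_subadditive_countably) (use m sp in auto)
  also have "\<dots> \<le> (\<Sum>n. a (n + N))"
    by (rule suminf_le[OF _ sp sa]) (use bound in auto)
  finally have "\<P>(\<omega> in M. \<not> (\<forall>n\<ge>N. W n \<omega>)) \<le> (\<Sum>n. a (n + N))" .
  moreover have "\<P>(\<omega> in M. \<not> (\<forall>n\<ge>N. W n \<omega>)) = 1 - \<P>(\<omega> in M. \<forall>n\<ge>N. W n \<omega>)"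
    by (rule prob_neg) measurable
  ultimately show ?thesis by simp
qed

text \<open>The factor 8 (n + 1) counts two ranking functions, n + 1 thresholds, two kinds of counts
  and the 2 in Hoeffding's inequality; the exponent is - 2 \<epsilon>^2 / n for \<epsilon> = n powr
  (3/4).\<close>

definition tail_bound :: "nat \<Rightarrow> real" where
  "tail_bound n = 8 * (real n + 1) * exp (- 2 * sqrt (real n))"

text \<open>The exponential is split into two equal factors: one supplies the decay in
  \<open>N\<close>, the other keeps the series convergent.\<close>

lemma tail_bound_le:
  assumes "N \<le> n"
  shows "tail_bound n \<le> exp (- sqrt (real N)) * (8 * (real n + 1) * exp (- sqrt (real n)))"
proof -
  have "exp (- 2 * sqrt (real n)) = exp (- sqrt (real n)) * exp (- sqrt (real n))"
    by (simp add: exp_add[symmetric])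
  also have "\<dots> \<le> exp (- sqrt (real N)) * exp (- sqrt (real n))"
    using assms by (intro mult_right_mono) auto
  finally have "8 * (real n + 1) * exp (- 2 * sqrt (real n)) \<le>
      8 * (real n + 1) * (exp (- sqrt (real N)) * exp (- sqrt (real n)))"
    by (rule mult_left_mono) simp
  then show ?thesis by (simp add: tail_bound_def mult_ac)
qed

lemma summable_tail_majorant: "summable (\<lambda>n. 8 * (real n + 1) * exp (- sqrt (real n)))"
proof (rule summable_comparison_test_bigo)
  show "summable (\<lambda>n. norm (1 / real n ^ 2))"
    using inverse_power_summable[of 2, where 'a = real] by (simp add: inverse_eq_divide)
  show "(\<lambda>n. 8 * (real n + 1) * exp (- sqrt (real n))) \<in> O(\<lambda>n. 1 / real n ^ 2)"
    by real_asymp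
qed

lemma summable_tail_bound: "summable tail_bound"
  by (rule summable_comparison_test'[OF summable_tail_majorant, of 0])
    (use tail_bound_le[of 0] in \<open>simp add: tail_bound_def\<close>)

lemma negligible_tail: "negligible_fun (\<lambda>N. \<Sum>n. tail_bound (n + N))"
proof -
  define b where "b = (\<lambda>n. 8 * (real n + 1) * exp (- sqrt (real n)))"
  have b: "summable b" unfolding b_def by (rule summable_tail_majorant)
  have b0: "0 \<le> b n" for n by (simp add: b_def)
  \<comment> \<open>The added 1 keeps \<open>T\<close> strictly positive without an estimate of the
    sum.\<close>
  define T where "T = suminf b + 1"
  have T: "0 < T" using suminf_nonneg[OF b b0] by (simp add: T_def)
  have le: "(\<Sum>n. tail_bound (n + N)) \<le> T * exp (- sqrt (real N))" for N
  proof -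
    have sb: "summable (\<lambda>n. b (n + N))" by (rule summable_ignore_initial_segment[OF b])
    have tb: "tail_bound (n + N) \<le> exp (- sqrt (real N)) * b (n + N)" for n
      unfolding b_def by (rule tail_bound_le) simp
    have "(\<Sum>n. tail_bound (n + N)) \<le> (\<Sum>n. exp (- sqrt (real N)) * b (n + N))"
      by (rule suminf_le[OF tb summable_ignore_initial_segment[OF summable_tail_bound] summable_mult[OF sb]])
    also have "\<dots> = exp (- sqrt (real N)) * (\<Sum>n. b (n + N))"
      by (rule suminf_mult[OF sb])
    also have "(\<Sum>n. b (n + N)) \<le> T"
      using suminf_split_initial_segment[OF b, of N] sum_nonneg[of "{..<N}" b] b0
      unfolding T_def by simp
    finally show ?thesis by (simp add: mult.commute mult_left_mono)
  qed
  have "\<forall>\<^sub>F N in sequentially. T * exp (- sqrt (real N)) < real N powr (- c)" for c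
    using T by real_asymp
  then show ?thesis
    unfolding negligible_fun_def
    by (metis (mono_tags, lifting) le eventually_mono le_less_trans)
qed

section \<open>Deviation events of the empirical counts\<close>

context ranking_model
begin

abbreviation samples :: "(nat \<Rightarrow> 'a \<times> real) measure" where
  "samples \<equiv> \<Pi>\<^sub>M i\<in>(UNIV :: nat set). P"

text \<open>By uniformity the threshold 1 - r/n has exactly \<open>r\<close> items above it in
  expectation, so it stands in for the rank \<open>r\<close>.\<close>

definition count_deviates :: "nat \<Rightarrow> real \<Rightarrow> nat \<Rightarrow> (nat \<Rightarrow> 'a \<times> real) \<Rightarrow> bool" where
  "count_deviates n \<epsilon> r \<omega> \<longleftrightarrow>
     \<bar>real (length (filter (\<lambda>z. 1 - real r / n < cscore z) (map \<omega> [0..<n]))) - real r\<bar> \<ge> \<epsilon>"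

definition label_count_deviates :: "nat \<Rightarrow> real \<Rightarrow> nat \<Rightarrow> (nat \<Rightarrow> 'a \<times> real) \<Rightarrow> bool" where
  "label_count_deviates n \<epsilon> r \<omega> \<longleftrightarrow>
     \<bar>sum_list (map snd (filter (\<lambda>z. 1 - real r / n < cscore z) (map \<omega> [0..<n])))
       - n * top_positives (real r / n)\<bar> \<ge> \<epsilon>"

lemma measurable_count_deviates [measurable]: "Measurable.pred samples (count_deviates n \<epsilon> r)"
proof -
  have [measurable]: "(\<lambda>z. of_bool (1 - real r / n < cscore z) :: real) \<in> borel_measurable P"
    by measurable
  show ?thesis unfolding count_deviates_def length_filter_sample by measurable
qed

lemma measurable_label_count_deviates [measurable]: "Measurable.pred samples (label_count_deviates n \<epsilon> r)"
proof -
  have [measurable]: "(\<lambda>z. snd z * of_bool (1 - real r / n < cscore z)) \<in> borel_measurable P"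
    by measurable
  show ?thesis unfolding label_count_deviates_def sum_labels_filter_sample by measurable
qed

lemma prob_count_deviates:
  assumes "0 < n" "r \<le> n" "0 \<le> \<epsilon>"
  shows "\<P>(\<omega> in samples. count_deviates n \<epsilon> r \<omega>) \<le> 2 * exp (- 2 * \<epsilon>\<^sup>2 / n)"
proof -
  let ?h = "\<lambda>z. of_bool (1 - real r / n < cscore z) :: real"
  have h: "?h \<in> borel_measurable P" by measurable
  have "(LINT z|P. ?h z) = (LINT z|P. indicator {z \<in> space P. 1 - real r / n < cscore z} z)"
    by (intro Bochner_Integration.integral_cong refl) (simp add: indicator_def)
  also have "\<dots> = real r / n"
    using prob_cscore_gt[of "real r / n"] assms by (simp add: divide_le_eq_1)
  finally have mean: "n * (LINT z|P. ?h z) = real r" using assms by simp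
  have "\<P>(\<omega> in samples. \<bar>(\<Sum>i<n. ?h (\<omega> i)) - n * (LINT z|P. ?h z)\<bar> \<ge> \<epsilon>) \<le> 2 * exp (- 2 * \<epsilon>\<^sup>2 / n)"
    by (rule Hoeffding_iid_sequence[OF prob_space_axioms h]) (use assms in auto)
  then show ?thesis
    unfolding count_deviates_def length_filter_sample mean .
qed

lemma prob_label_count_deviates:
  assumes "0 < n" "0 \<le> \<epsilon>"
  shows "\<P>(\<omega> in samples. label_count_deviates n \<epsilon> r \<omega>) \<le> 2 * exp (- 2 * \<epsilon>\<^sup>2 / n)"
proof -
  let ?h = "\<lambda>z. snd z * of_bool (1 - real r / n < cscore z)"
  have h: "?h \<in> borel_measurable P" by measurable
  have "(LINT z|P. ?h z) = (LINT z|P. indicator {z \<in> space P. snd z = 1 \<and> 1 - real r / n < cscore z} z)"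
    by (intro Bochner_Integration.integral_cong refl) (use label_cases in \<open>auto simp: indicator_def\<close>)
  also have "\<dots> = top_positives (real r / n)"
    by (simp add: top_positives_def)
  finally have mean: "(LINT z|P. ?h z) = top_positives (real r / n)" .
  have "\<P>(\<omega> in samples. \<bar>(\<Sum>i<n. ?h (\<omega> i)) - n * (LINT z|P. ?h z)\<bar> \<ge> \<epsilon>) \<le> 2 * exp (- 2 * \<epsilon>\<^sup>2 / n)"
  proof (rule Hoeffding_iid_sequence[OF prob_space_axioms h _ assms])
    show "?h z \<in> {0..1}" if "z \<in> space P" for z
      using label_cases[OF that] by auto
  qed
  then show ?thesis
    unfolding label_count_deviates_def sum_labels_filter_sample mean .
qed

definition some_count_deviates :: "nat \<Rightarrow> real \<Rightarrow> (nat \<Rightarrow> 'a \<times> real) \<Rightarrow> bool" where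
  "some_count_deviates n \<epsilon> \<omega> \<longleftrightarrow> (\<exists>r\<in>{..n}. count_deviates n \<epsilon> r \<omega> \<or> label_count_deviates n \<epsilon> r \<omega>)"

lemma measurable_some_count_deviates [measurable]: "Measurable.pred samples (some_count_deviates n \<epsilon>)"
  unfolding some_count_deviates_def by measurable

lemma prob_some_count_deviates:
  assumes "0 < n" "0 \<le> \<epsilon>"
  shows "\<P>(\<omega> in samples. some_count_deviates n \<epsilon> \<omega>) \<le> 4 * (real n + 1) * exp (- 2 * \<epsilon>\<^sup>2 / n)"
proof -
  interpret S: prob_space samples by (rule prob_space_PiM) (rule prob_space_axioms)
  let ?C = "\<lambda>r. {\<omega> \<in> space samples. count_deviates n \<epsilon> r \<omega>}"
  let ?L = "\<lambda>r. {\<omega> \<in> space samples. label_count_deviates n \<epsilon> r \<omega>}"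
  have meas: "?C r \<in> sets samples" "?L r \<in> sets samples" for r by measurable
  have "\<P>(\<omega> in samples. some_count_deviates n \<epsilon> \<omega>) = measure samples (\<Union>r\<in>{..n}. ?C r \<union> ?L r)"
    by (intro arg_cong[where f = "measure samples"]) (auto simp: some_count_deviates_def)
  also have "\<dots> \<le> (\<Sum>r\<in>{..n}. measure samples (?C r \<union> ?L r))"
    using meas by (intro S.finite_measure_subadditive_finite) auto
  also have "\<dots> \<le> (\<Sum>r\<in>{..n}. 4 * exp (- 2 * \<epsilon>\<^sup>2 / n))"
  proof (rule sum_mono)
    fix r assume "r \<in> {..n}"
    then show "measure samples (?C r \<union> ?L r) \<le> 4 * exp (- 2 * \<epsilon>\<^sup>2 / n)"
      using measure_Un_le[OF meas, of r r] prob_count_deviates[OF assms(1) _ assms(2), of r]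
        prob_label_count_deviates[OF assms, of r] by simp
  qed
  also have "\<dots> = 4 * (real n + 1) * exp (- 2 * \<epsilon>\<^sup>2 / n)" by simp
  finally show ?thesis .
qed

end

text \<open>The main term of the DCG difference is of order n / (ln n)^k with the sign of
  \<open>c\<close>. Off the deviation events the error is at most a constant times n powr (3/4), so
  the sign is decided for all large \<open>n\<close>.\<close>

lemma NDCG_consistently_greater:
  assumes "ranking_model MX P f g" "ranking_model MX P f' g'" and "0 < c"
    and lim: "(\<lambda>n. ln (real n) ^ k * (\<Sum>r = 1..<n. (log_discount r - log_discount (r + 1)) *
       (ranking_model.top_positives MX P f (real r / real n) - ranking_model.top_positives MX P f' (real r / real n))))
      \<longlonglongrightarrow> c"
  shows "\<forall>\<^sub>F N in sequentially.
    \<P>(\<omega> in (\<Pi>\<^sub>M i\<in>(UNIV :: nat set). P).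
       \<forall>n\<ge>N. NDCG log_discount f' (map \<omega> [0..<n]) < NDCG log_discount f (map \<omega> [0..<n]))
    \<ge> 1 - (\<Sum>n. tail_bound (n + N))"
proof -
  interpret F: ranking_model MX P f g by fact
  interpret F': ranking_model MX P f' g' by fact
  let ?S = "\<Pi>\<^sub>M i\<in>(UNIV :: nat set). P"
  interpret S: prob_space ?S by (rule prob_space_PiM) (rule F.prob_space_axioms)
  let ?M = "\<lambda>n. \<Sum>r = 1..<n. (log_discount r - log_discount (r + 1)) *
       (F.top_positives (real r / real n) - F'.top_positives (real r / real n))"
  \<comment> \<open>The exponent 3/4 is below 1, so the error is lost against n / (ln n)^k, and
    above 1/2, so that the Hoeffding exponent 2 \<epsilon>^2 / n = 2 sqrt n still grows.\<close>
  let ?\<epsilon> = "\<lambda>n::nat. real n powr (3/4)"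
  let ?D = "log_discount 1"
  let ?W = "\<lambda>n \<omega>. DCG log_discount f' (map \<omega> [0..<n]) < DCG log_discount f (map \<omega> [0..<n])"
  have "\<forall>\<^sub>F n in sequentially. c / 2 < ln (real n) ^ k * ?M n"
    using order_tendstoD(1)[OF lim, of "c / 2"] \<open>0 < c\<close> by simp
  moreover have "(\<lambda>n. ln (real n) ^ k * (4 * ?\<epsilon> n * ?D) / real n) \<longlonglongrightarrow> 0"
    by real_asymp
  then have "\<forall>\<^sub>F n in sequentially. ln (real n) ^ k * (4 * ?\<epsilon> n * ?D) / real n < c / 2"
    by (rule order_tendstoD(2)) (use \<open>0 < c\<close> in simp)
  ultimately have "\<forall>\<^sub>F n in sequentially. 4 * ?\<epsilon> n * ?D < n * ?M n"
    using eventually_gt_at_top[of 1]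
  proof eventually_elim
    case (elim n)
    then have "ln (real n) ^ k * (4 * ?\<epsilon> n * ?D / real n) < ln (real n) ^ k * ?M n" by simp
    moreover have "0 \<le> ln (real n) ^ k" using elim by simp
    ultimately have "4 * ?\<epsilon> n * ?D / real n < ?M n"
      by (rule mult_left_less_imp_less)
    then show ?case using elim by (simp add: pos_divide_less_eq mult.commute)
  qed
  then obtain n0 where n0: "\<And>n. n0 \<le> n \<Longrightarrow> 4 * ?\<epsilon> n * ?D < n * ?M n"
    by (auto simp: eventually_sequentially)
  have space: "\<omega> i \<in> space P" if "\<omega> \<in> space ?S" for \<omega> i
    using that by (auto simp: space_PiM)
  have W: "?W n \<omega>" if "\<omega> \<in> space ?S" "n0 \<le> n" "0 < n"
    and dev: "\<not> F.some_count_deviates n (?\<epsilon> n) \<omega>" "\<not> F'.some_count_deviates n (?\<epsilon> n) \<omega>" for n \<omega>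
  proof -
    have "\<bar>DCG log_discount f (map \<omega> [0..<n]) - DCG log_discount f' (map \<omega> [0..<n]) - n * ?M n\<bar>
        \<le> 4 * ?\<epsilon> n * ?D"
    proof (rule DCG_difference_approx[OF F.mono_score_cdf F'.mono_score_cdf])
      show "snd z \<in> {0..1}" if z: "z \<in> set (map \<omega> [0..<n])" for z
      proof -
        obtain i where "z = \<omega> i" using z by auto
        then show ?thesis using F.label_cases[OF space[OF \<open>\<omega> \<in> space ?S\<close>], of i] by auto
      qed
    qed (use dev \<open>0 < n\<close> log_discount_antimono log_discount_nonneg in
        \<open>auto simp: F.some_count_deviates_def F'.some_count_deviates_def F.count_deviates_def
          F'.count_deviates_def F.label_count_deviates_def F'.label_count_deviates_def not_le
          intro: less_imp_le\<close>)
    then show ?thesis using n0[OF \<open>n0 \<le> n\<close>] by linarith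
  qed
  have DCG_meas [measurable]:
    "(\<lambda>\<omega>. DCG log_discount f (map \<omega> [0..<n])) \<in> borel_measurable ?S"
    "(\<lambda>\<omega>. DCG log_discount f' (map \<omega> [0..<n])) \<in> borel_measurable ?S" for n
    by (intro measurable_DCG_sample F.measurable_score F'.measurable_score F.measurable_snd_P)+
  have bound: "\<P>(\<omega> in ?S. \<not> ?W n \<omega>) \<le> tail_bound n" if n: "n0 \<le> n" "0 < n" for n
  proof -
    let ?B = "{\<omega> \<in> space ?S. F.some_count_deviates n (?\<epsilon> n) \<omega>}"
    let ?B' = "{\<omega> \<in> space ?S. F'.some_count_deviates n (?\<epsilon> n) \<omega>}"
    have meas: "?B \<in> sets ?S" "?B' \<in> sets ?S" by measurable
    have "\<P>(\<omega> in ?S. \<not> ?W n \<omega>) \<le> measure ?S (?B \<union> ?B')"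
      using W n meas by (intro S.finite_measure_mono) auto
    also have "\<dots> \<le> measure ?S ?B + measure ?S ?B'"
      by (rule measure_Un_le[OF meas])
    also have "\<dots> \<le> 8 * (real n + 1) * exp (- 2 * (?\<epsilon> n)\<^sup>2 / n)"
      using F.prob_some_count_deviates[of n "?\<epsilon> n"] F'.prob_some_count_deviates[of n "?\<epsilon> n"] n
      by (simp add: algebra_simps)
    also have "- 2 * (?\<epsilon> n)\<^sup>2 / n = - 2 * sqrt n"
    proof -
      have "(?\<epsilon> n)\<^sup>2 = real n powr (1 + 1/2)"
        using n by (simp add: powr_power)
      also have "\<dots> = n * sqrt n"
        using n by (simp only: powr_add) (simp add: powr_half_sqrt)
      finally show ?thesis using n by simp
    qed
    finally show ?thesis by (simp add: tail_bound_def)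
  qed
  show ?thesis
    using eventually_ge_at_top[of "max 1 n0"]
  proof eventually_elim
    case (elim N)
    have "1 - (\<Sum>n. tail_bound (n + N)) \<le> \<P>(\<omega> in ?S. \<forall>n\<ge>N. ?W n \<omega>)"
      by (rule S.prob_all_ge_lower_bound[OF _ _ summable_tail_bound]) (use elim bound in auto)
    \<comment> \<open>Only here does the comparison pass from DCG to NDCG; measurability was needed
      for DCG alone.\<close>
    also have "{\<omega> \<in> space ?S. \<forall>n\<ge>N. ?W n \<omega>} = {\<omega> \<in> space ?S. \<forall>n\<ge>N.
        NDCG log_discount f' (map \<omega> [0..<n]) < NDCG log_discount f (map \<omega> [0..<n])}"
    proof -
      have "NDCG log_discount f' (map \<omega> [0..<n]) < NDCG log_discount f (map \<omega> [0..<n]) \<longleftrightarrow> ?W n \<omega>"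
        if "\<omega> \<in> space ?S" for \<omega> n
      proof (rule NDCG_less_iff_DCG_less)
        fix z assume "z \<in> set (map \<omega> [0..<n])"
        then obtain i where "z = \<omega> i" by auto
        then show "0 \<le> snd z"
          using F.label_cases[OF space[OF \<open>\<omega> \<in> space ?S\<close>], of i] by auto
      qed (rule log_discount_nonneg)
      then show ?thesis by auto
    qed
    finally show ?case .
  qed
qed

section \<open>Separation of distinct label probabilities and the conclusion\<close>

lemma holder_continuous_on_imp_continuous_on:
  assumes "holder_continuous_on A g"
  shows "continuous_on A g"
proof -
  obtain C \<alpha> where \<alpha>: "0 < \<alpha>"
    and H: "\<And>s t. s \<in> A \<Longrightarrow> t \<in> A \<Longrightarrow> \<bar>g s - g t\<bar> \<le> C * \<bar>s - t\<bar> powr \<alpha>"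
    using assms unfolding holder_continuous_on_def by blast
  show ?thesis
    unfolding continuous_on_iff
  proof (intro ballI allI impI)
    fix s e :: real assume s: "s \<in> A" and "0 < e"
    \<comment> \<open>Solves (|C| + 1) d^\<alpha> = e; using |C| + 1 avoids division by zero and any
      discussion of the sign of \<open>C\<close>.\<close>
    define d where "d = (e / (\<bar>C\<bar> + 1)) powr (1 / \<alpha>)"
    have "0 < d" using \<open>0 < e\<close> by (simp add: d_def)
    have d: "d powr \<alpha> = e / (\<bar>C\<bar> + 1)"
      using \<alpha> \<open>0 < e\<close> by (simp add: d_def powr_powr)
    have "dist (g u) (g s) < e" if u: "u \<in> A" "dist u s < d" for u
    proof -
      have "\<bar>u - s\<bar> powr \<alpha> < d powr \<alpha>"
        using \<alpha> u(2) by (intro powr_less_mono2) (auto simp: dist_real_def)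
      then have "(\<bar>C\<bar> + 1) * \<bar>u - s\<bar> powr \<alpha> < e"
        unfolding d by (simp add: pos_less_divide_eq mult.commute)
      moreover have "C * \<bar>u - s\<bar> powr \<alpha> \<le> (\<bar>C\<bar> + 1) * \<bar>u - s\<bar> powr \<alpha>"
        by (intro mult_right_mono) auto
      ultimately show ?thesis using H[OF u(1) s] by (simp add: dist_real_def)
    qed
    with \<open>0 < d\<close> show "\<exists>d>0. \<forall>u\<in>A. dist u s < d \<longrightarrow> dist (g u) (g s) < e" by blast
  qed
qed

text \<open>A strict gap at \<open>s\<close> would persist on a whole interval around
  \<open>s\<close> by continuity, and the common increment of the two \<open>top_positives\<close>
  over it would have to lie on both sides of the gap. Equality follows by exchanging the
  roles.\<close>

lemma label_prob_le_of_top_positives_eq: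
  assumes "ranking_model MX P f g" "ranking_model MX P f' g'"
    and eq: "\<And>x. x \<in> {0..1} \<Longrightarrow> ranking_model.top_positives MX P f x = ranking_model.top_positives MX P f' x"
    and cont: "continuous_on {0..1} g" "continuous_on {0..1} g'" and s: "s \<in> {0..1}"
  shows "g s \<le> g' s"
proof (rule ccontr)
  interpret F: ranking_model MX P f g by fact
  interpret F': ranking_model MX P f' g' by fact
  assume "\<not> g s \<le> g' s"
  \<comment> \<open>A third of the gap, so that g s - d still exceeds g' s + d.\<close>
  define d where "d = (g s - g' s) / 3"
  have "0 < d" using \<open>\<not> g s \<le> g' s\<close> by (simp add: d_def)
  obtain \<delta> where "0 < \<delta>" and \<delta>: "\<And>u. u \<in> {0..1} \<Longrightarrow> \<bar>u - s\<bar> < \<delta> \<Longrightarrow> \<bar>g u - g s\<bar> < d"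
    using cont(1)[unfolded continuous_on_iff, rule_format, OF s \<open>0 < d\<close>] by (auto simp: dist_real_def)
  obtain \<delta>' where "0 < \<delta>'" and \<delta>': "\<And>u. u \<in> {0..1} \<Longrightarrow> \<bar>u - s\<bar> < \<delta>' \<Longrightarrow> \<bar>g' u - g' s\<bar> < d"
    using cont(2)[unfolded continuous_on_iff, rule_format, OF s \<open>0 < d\<close>] by (auto simp: dist_real_def)
  define \<eta> where "\<eta> = min \<delta> \<delta>' / 2"
  have \<eta>: "0 < \<eta>" "\<eta> < \<delta>" "\<eta> < \<delta>'" using \<open>0 < \<delta>\<close> \<open>0 < \<delta>'\<close> by (auto simp: \<eta>_def)
  \<comment> \<open>Clipping to the unit interval leaves an interval of positive length even if
    \<open>s\<close> is an endpoint.\<close>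
  define a where "a = max 0 (s - \<eta>)"
  define b where "b = min 1 (s + \<eta>)"
  have ab: "0 \<le> a" "a < b" "b \<le> 1" using s \<eta> by (auto simp: a_def b_def)
  have u: "u \<in> {0..1} \<and> \<bar>u - s\<bar> < \<delta> \<and> \<bar>u - s\<bar> < \<delta>'" if "u \<in> {a..b}" for u
    using that \<eta> by (auto simp: a_def b_def)
  have "(g s - d) * (b - a) \<le> F.top_positives (1 - a) - F.top_positives (1 - b)"
  proof (rule F.cond_label_prob_interval(2))
    show "g s - d \<le> g v" if "v \<in> {a..b}" for v
      using \<delta>[of v] u[OF that] by auto
  qed (use ab in auto)
  also have "\<dots> = F'.top_positives (1 - a) - F'.top_positives (1 - b)"
    using ab by (simp add: eq)
  also have "\<dots> \<le> (g' s + d) * (b - a)"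
  proof (rule F'.cond_label_prob_interval(1))
    show "g' v \<le> g' s + d" if "v \<in> {a..b}" for v
      using \<delta>'[of v] u[OF that] by auto
  qed (use ab in auto)
  finally have "g s - d \<le> g' s + d" using ab by simp
  then show False using \<open>0 < d\<close> by (simp add: d_def field_simps)
qed

theorem theorem2:
  fixes MX :: "'a measure" and P :: "('a \<times> real) measure"
    and f\<^sub>0 f\<^sub>1 :: "'a \<Rightarrow> real" and y\<^sub>0 y\<^sub>1 :: "real \<Rightarrow> real"
  assumes "prob_space P"
    and "sets P = sets (MX \<Otimes>\<^sub>M count_space {0, 1})"
    and "f\<^sub>0 \<in> borel_measurable MX" and "f\<^sub>1 \<in> borel_measurable MX"
    and "\<And>t. \<P>(x in distr P MX fst. f\<^sub>0 x = t) = 0"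
    and "\<And>t. \<P>(x in distr P MX fst. f\<^sub>1 x = t) = 0"
    and "cond_label_prob MX P f\<^sub>0 y\<^sub>0" and "cond_label_prob MX P f\<^sub>1 y\<^sub>1"
    and "holder_continuous_on {0..1} y\<^sub>0" and "holder_continuous_on {0..1} y\<^sub>1"
    and "\<not> (AE s\<in>{0..1} in lborel. y\<^sub>0 s = y\<^sub>1 s)"
  shows "consistently_distinguishable P (NDCG log_discount) f\<^sub>0 f\<^sub>1"
proof -
  have m0: "ranking_model MX P f\<^sub>0 y\<^sub>0" and m1: "ranking_model MX P f\<^sub>1 y\<^sub>1"
    using assms(1-8) by (simp_all add: ranking_model_def ranking_model_axioms_def)
  interpret F\<^sub>0: ranking_model MX P f\<^sub>0 y\<^sub>0 by (rule m0)
  interpret F\<^sub>1: ranking_model MX P f\<^sub>1 y\<^sub>1 by (rule m1)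
  let ?\<Phi> = "\<lambda>x. F\<^sub>0.top_positives x - F\<^sub>1.top_positives x"
  have cont: "continuous_on {0..1} y\<^sub>0" "continuous_on {0..1} y\<^sub>1"
    using assms(9,10) by (auto intro: holder_continuous_on_imp_continuous_on)
  \<comment> \<open>The values at 0 and 1 always agree, so vanishing on the open interval would
    force equality of \<open>top_positives\<close> on the closed one, and then of the label
    probabilities everywhere.\<close>
  have "\<exists>x0\<in>{0<..<1}. ?\<Phi> x0 \<noteq> 0"
  proof (rule ccontr)
    assume "\<not> ?thesis"
    then have eq: "F\<^sub>0.top_positives x = F\<^sub>1.top_positives x" if "x \<in> {0..1}" for x
      using that F\<^sub>0.top_positives_0 F\<^sub>1.top_positives_0
        F\<^sub>0.top_positives_ge_1[of 1] F\<^sub>1.top_positives_ge_1[of 1]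
      by (cases "x = 0 \<or> x = 1") auto
    have "y\<^sub>0 s = y\<^sub>1 s" if "s \<in> {0..1}" for s
      using label_prob_le_of_top_positives_eq[OF m0 m1 eq cont that]
        label_prob_le_of_top_positives_eq[OF m1 m0 eq[symmetric] cont(2,1) that]
      by (auto intro: antisym)
    with assms(11) show False by simp
  qed
  then obtain x0 where x0: "x0 \<in> {0<..<1}" "?\<Phi> x0 \<noteq> 0" by blast
  obtain k c where "c \<noteq> 0" and lim: "(\<lambda>n. ln (real n) ^ k *
      (\<Sum>r = 1..<n. (log_discount r - log_discount (r + 1)) * ?\<Phi> (real r / real n))) \<longlonglongrightarrow> c"
  proof (rule discounted_sum_asymptotics[of ?\<Phi> 2, OF _ _ _ x0])
    \<comment> \<open>Each of the two functions has Lipschitz constant 1, hence the 2.\<close>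
    show "\<bar>?\<Phi> x - ?\<Phi> y\<bar> \<le> 2 * \<bar>x - y\<bar>" for x y
      using F\<^sub>0.top_positives_lipschitz[of x y] F\<^sub>1.top_positives_lipschitz[of x y]
        abs_triangle_ineq4[of "F\<^sub>0.top_positives x - F\<^sub>0.top_positives y"
          "F\<^sub>1.top_positives x - F\<^sub>1.top_positives y"]
      by (simp add: algebra_simps)
  qed (simp_all add: F\<^sub>0.top_positives_0 F\<^sub>1.top_positives_0 F\<^sub>0.top_positives_ge_1 F\<^sub>1.top_positives_ge_1)
  \<comment> \<open>The sign of \<open>c\<close> decides which ranking function wins; for negative
    \<open>c\<close> the roles are exchanged.\<close>
  show ?thesis
  proof (cases "0 < c")
    case True
    show ?thesis
      unfolding consistently_distinguishable_def
      using NDCG_consistently_greater[OF m0 m1 True lim] negligible_tail by blast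
  next
    case False
    then have "0 < - c" using \<open>c \<noteq> 0\<close> by simp
    moreover have "(\<lambda>n. ln (real n) ^ k *
      (\<Sum>r = 1..<n. (log_discount r - log_discount (r + 1)) *
        (F\<^sub>1.top_positives (real r / real n) - F\<^sub>0.top_positives (real r / real n)))) \<longlonglongrightarrow> - c"
    proof -
      have "(\<Sum>r = 1..<n. (log_discount r - log_discount (r + 1)) *
        (F\<^sub>1.top_positives (real r / real n) - F\<^sub>0.top_positives (real r / real n))) =
        - (\<Sum>r = 1..<n. (log_discount r - log_discount (r + 1)) * ?\<Phi> (real r / real n))" for n
        unfolding sum_negf[symmetric] by (intro sum.cong refl) (simp add: algebra_simps)
      then show ?thesis using tendsto_minus[OF lim] by simp
    qed
    ultimately show ?thesis
      unfolding consistently_distinguishable_def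
      using NDCG_consistently_greater[OF m1 m0] negligible_tail by blast
  qed
qed

end
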